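(* Let $R$ be an integral domain, $1\neq q\in R^\times$, $\mathbf{Q}=(Q_1,\dots,Q_\ell)\in R^\ell$, and let $\mathscr{H}_{\ell,n}=\mathscr{H}_{\ell,n}^R(q;\mathbf{Q})$ be the non-degenerate cyclotomic Hecke algebra of type $G(\ell,1,n)$, with standard symmetrizing form $\tau_R^{\mathrm{MM}}$ and Murphy basis $\{\mathfrak{m}_{\mathfrak{s}\mathfrak{t}}\}$. Let $\boldsymbol{\lambda}\in\mathscr{P}_{\ell,n}$ and $\mathfrak{s},\mathfrak{t}\in\mathrm{Std}(\boldsymbol{\lambda})$. Then $$\tau_R^{\mathrm{MM}}(\mathfrak{m}_{\mathfrak{s}\mathfrak{t}})=\begin{cases} q^{\sum_{k=1}^n (k-k(\mathfrak{t}_{\downarrow\leq k}))}\Big(\prod_{j=1}^n\prod_{i=l(\mathfrak{t},j)+1}^{\ell}(-Q_i)\Big), & \text{if } \mathfrak{s}=\mathfrak{t},\\ 0, & \text{if }\mathfrak{s}\neq\mathfrak{t}.\end{cases}$$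
   Context: Algebra. Let $\ell,n\ge 1$. $\mathscr{H}_{\ell,n}$ is the unital associative $R$-algebra with generators $T_0,T_1,\dots,T_{n-1}$ and relations: $(T_0-Q_1)\cdots(T_0-Q_\ell)=0$; $T_0T_1T_0T_1=T_1T_0T_1T_0$; $(T_i-q)(T_i+1)=0$ for $1\le i\le n-1$; $T_iT_j=T_jT_i$ for $0\le i<j-1<n-1$; $T_iT_{i+1}T_i=T_{i+1}T_iT_{i+1}$ for $1\le i<n-1$. Put $\mathcal{L}_1=T_0$ and $\mathcal{L}_{k+1}=q^{-1}T_k\mathcal{L}_kT_k$ for $1\le k\le n-1$; these commute. $\mathfrak{S}_n$ is the symmetric group with $\sigma_i=(i,i+1)$, acting on $\{1,\dots,n\}$ from the right (in a product the left factor is applied first); for a reduced expression $w=\sigma_{i_1}\cdots\sigma_{i_k}$ put $T_w=T_{i_1}\cdots T_{i_k}$ (well defined). $*$ is the $R$-algebra anti-automorphism of $\mathscr{H}_{\ell,n}$ fixing $T_0,\dots,T_{n-1}$. Form. $\mathscr{H}_{\ell,n}$ is $R$-free with basis $\{\mathcal{L}_1^{c_1}\cdots\mathcal{L}_n^{c_n}T_w\mid w\in\mathfrak{S}_n,\ 0\le c_i\le\ell-1\}$ (Ariki–Koike). $\tau_R^{\mathrm{MM}}:\mathscr{H}_{\ell,n}\to R$ is the $R$-linear map with value $1$ on the basis element with $w=1$, $c_1=\cdots=c_n=0$, and $0$ on all other basis elements. Combinatorics. $\mathscr{P}_{\ell,n}$ is the set of $\ell$-partitions $\boldsymbol{\lambda}=(\lambda^{(1)},\dots,\lambda^{(\ell)})$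 of $n$; its Young diagram is $[\boldsymbol{\lambda}]=\{(r,c,l)\mid 1\le l\le\ell,\ r\ge1,\ 1\le c\le\lambda^{(l)}_r\}$. A $\boldsymbol{\lambda}$-tableau is a bijection $\mathfrak{t}:[\boldsymbol{\lambda}]\to\{1,\dots,n\}$; it is standard if in every component entries increase along rows and down columns. $\mathrm{Std}(\boldsymbol{\lambda})$ is the set of standard $\boldsymbol{\lambda}$-tableaux. $\mathfrak{t}^{\boldsymbol{\lambda}}$ is the tableau with $1,2,\dots,n$ entered in order along successive rows of $\lambda^{(1)}$, then $\lambda^{(2)}$, etc. $d(\mathfrak{t})\in\mathfrak{S}_n$ is the unique element with $\mathfrak{t}=\mathfrak{t}^{\boldsymbol{\lambda}}d(\mathfrak{t})$ (right action on entries). $\mathfrak{t}_{\downarrow\le k}$ is the subtableau of $\mathfrak{t}$ containing the entries $1,\dots,k$, a standard tableau whose shape is an $\ell$-partition of $k$. For a standard tableau $\mathfrak{t}$ of shape $\boldsymbol{\lambda}\in\mathscr{P}_{\ell,k}$, $k(\mathfrak{t})\in\{1,\dots,k\}$ is the unique integer with $\mathfrak{t}^{-1}(k)=(\mathfrak{t}^{\boldsymbol{\lambda}})^{-1}(k(\mathfrak{t}))$. Write $\mathfrak{t}^{-1}(j)=(r(\mathfrak{t},j),c(\mathfrak{t},j),l(\mathfrak{t},j))$, so $l(\mathfrak{t},j)$ is the component containing $j$. Murphy basis. $\mathfrak{S}_{\boldsymbol{\lambda}}\le\mathfrak{S}_n$ is the Young subgroup of the composition obtained by listing all the nonzero row lengths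 of $\lambda^{(1)}$, then $\lambda^{(2)}$, etc. (the row stabilizer of $\mathfrak{t}^{\boldsymbol{\lambda}}$). Put $\mathfrak{a}_s=|\lambda^{(1)}|+\cdots+|\lambda^{(s-1)}|$, $x_{\boldsymbol{\lambda}}=\sum_{w\in\mathfrak{S}_{\boldsymbol{\lambda}}}T_w$, $\mathfrak{u}^+_{\boldsymbol{\lambda}}=\prod_{s=2}^{\ell}\prod_{k=1}^{\mathfrak{a}_s}(\mathcal{L}_k-Q_s)$, $\mathfrak{m}_{\boldsymbol{\lambda}}=x_{\boldsymbol{\lambda}}\mathfrak{u}^+_{\boldsymbol{\lambda}}$ and $\mathfrak{m}_{\mathfrak{s}\mathfrak{t}}=T_{d(\mathfrak{s})}^*\,\mathfrak{m}_{\boldsymbol{\lambda}}\,T_{d(\mathfrak{t})}$ for $\mathfrak{s},\mathfrak{t}\in\mathrm{Std}(\boldsymbol{\lambda})$. *)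

theory Defs
  imports
    "HOL-Algebra.QuotRing"
    "HOL-Combinatorics.Permutations"
    "HOL-Library.Poly_Mapping"
    "HOL-Library.FuncSet"
begin

section \<open>Free algebras\<close>

text \<open>
  The class \<^class>\<open>monoid_add\<close> is not commutative; its addition is concatenation here, so that
  finitely supported functions on words, with convolution product, form the free algebra.
\<close>

datatype word = Word (letters: "nat list")

instantiation word :: monoid_add
begin

definition zero_word :: word where
  "0 = Word []"

definition plus_word :: "word \<Rightarrow> word \<Rightarrow> word" where
  "u + v = Word (letters u @ letters v)"

instance
  by standard (simp_all add: zero_word_def plus_word_def)

end

type_synonym 'r free_alg = "word \<Rightarrow>\<^sub>0 'r"

definition free_var :: "nat \<Rightarrow> 'r::comm_ring_1 free_alg" where
  "free_var i = Poly_Mapping.single (Word [i]) 1"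

definition free_const :: "'r::comm_ring_1 \<Rightarrow> 'r free_alg" where
  "free_const r = Poly_Mapping.single 0 r"

text \<open>The free algebra on the generators with indices \<open>0, \<dots>, n - 1\<close>.\<close>

definition free_algebra :: "nat \<Rightarrow> ('r::comm_ring_1 free_alg) ring" where
  "free_algebra n =
    \<lparr>carrier = {p. \<forall>w\<in>Poly_Mapping.keys p. set (letters w) \<subseteq> {..<n}},
     monoid.mult = (\<lambda>x y. x * y), one = 1, ring.zero = 0, add = (\<lambda>x y. x + y)\<rparr>"


section \<open>Symmetric groups\<close>

text \<open>
  Permutations act from the right, so the leftmost letter of a word is applied first, whereas
  composition of functions applies the right factor first.
\<close>

primrec perm_of_word :: "nat list \<Rightarrow> nat \<Rightarrow> nat" where
  "perm_of_word [] = id"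
| "perm_of_word (i # is) = perm_of_word is \<circ> transpose i (Suc i)"

definition reduced_expression :: "nat \<Rightarrow> (nat \<Rightarrow> nat) \<Rightarrow> nat list \<Rightarrow> bool" where
  "reduced_expression n w is \<longleftrightarrow>
    set is \<subseteq> {1..<n} \<and> perm_of_word is = w \<and>
    (\<forall>js. set js \<subseteq> {1..<n} \<and> perm_of_word js = w \<longrightarrow> length is \<le> length js)"

definition young_subgroup :: "nat list \<Rightarrow> (nat \<Rightarrow> nat) set" where
  "young_subgroup a =
    {w. w permutes {1..sum_list a} \<and>
        (\<forall>i<length a. w ` {sum_list (take i a)<..sum_list (take (Suc i) a)}
                       = {sum_list (take i a)<..sum_list (take (Suc i) a)})}"


section \<open>Multipartitions and tableaux\<close>

type_synonym multipartition = "nat list list"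
type_synonym node = "nat \<times> nat \<times> nat"
type_synonym tableau = "node \<Rightarrow> nat"

definition mp_size :: "multipartition \<Rightarrow> nat" where
  "mp_size \<Lambda> = sum_list (map sum_list \<Lambda>)"

text \<open>Each component is the list of its nonzero parts; list positions start at \<open>0\<close>.\<close>

definition multipartitions :: "nat \<Rightarrow> nat \<Rightarrow> multipartition set" where
  "multipartitions ell n =
    {\<Lambda>. length \<Lambda> = ell \<and> (\<forall>p\<in>set \<Lambda>. sorted_wrt (\<ge>) p \<and> 0 \<notin> set p) \<and> mp_size \<Lambda> = n}"

definition diagram :: "multipartition \<Rightarrow> node set" where
  "diagram \<Lambda> =
    {(r, c, l). 1 \<le> l \<and> l \<le> length \<Lambda> \<and> 1 \<le> r \<and> r \<le> length (\<Lambda> ! (l - 1)) \<and>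
                1 \<le> c \<and> c \<le> \<Lambda> ! (l - 1) ! (r - 1)}"

text \<open>
  Extensionality makes equality of tableaux the same as equality on the diagram.
\<close>

definition tableaux :: "multipartition \<Rightarrow> tableau set" where
  "tableaux \<Lambda> = {t \<in> extensional (diagram \<Lambda>). bij_betw t (diagram \<Lambda>) {1..mp_size \<Lambda>}}"

definition standard_tableaux :: "multipartition \<Rightarrow> tableau set" where
  "standard_tableaux \<Lambda> =
    {t \<in> tableaux \<Lambda>.
      (\<forall>r c c' l. (r, c, l) \<in> diagram \<Lambda> \<and> (r, c', l) \<in> diagram \<Lambda> \<and> c < c'
         \<longrightarrow> t (r, c, l) < t (r, c', l)) \<and>
      (\<forall>r r' c l. (r, c, l) \<in> diagram \<Lambda> \<and> (r', c, l) \<in> diagram \<Lambda> \<and> r < r'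
         \<longrightarrow> t (r, c, l) < t (r', c, l))}"

text \<open>
  The entry at a node counts the nodes in earlier components, those in earlier rows of its own
  component, and those weakly to its left in its row.
\<close>

definition initial_tableau :: "multipartition \<Rightarrow> tableau" where
  "initial_tableau \<Lambda> =
    (\<lambda>(r, c, l)\<in>diagram \<Lambda>.
      mp_size (take (l - 1) \<Lambda>) + sum_list (take (r - 1) (\<Lambda> ! (l - 1))) + c)"

definition position :: "multipartition \<Rightarrow> tableau \<Rightarrow> nat \<Rightarrow> node" where
  "position \<Lambda> t j = inv_into (diagram \<Lambda>) t j"

definition component :: "multipartition \<Rightarrow> tableau \<Rightarrow> nat \<Rightarrow> nat" where
  "component \<Lambda> t j = snd (snd (position \<Lambda> t j))"

definition tableau_perm :: "multipartition \<Rightarrow> tableau \<Rightarrow> nat \<Rightarrow> nat" where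
  "tableau_perm \<Lambda> t =
    (THE d. d permutes {1..mp_size \<Lambda>} \<and> (\<forall>x\<in>diagram \<Lambda>. t x = d (initial_tableau \<Lambda> x)))"

definition sub_shape :: "multipartition \<Rightarrow> tableau \<Rightarrow> nat \<Rightarrow> multipartition" where
  "sub_shape \<Lambda> t k =
    (THE M. M \<in> multipartitions (length \<Lambda>) k \<and> diagram M = {x \<in> diagram \<Lambda>. t x \<le> k})"

definition sub_tableau :: "multipartition \<Rightarrow> tableau \<Rightarrow> nat \<Rightarrow> tableau" where
  "sub_tableau \<Lambda> t k = restrict t {x \<in> diagram \<Lambda>. t x \<le> k}"

text \<open>The number \<open>k(t)\<close> attached to a standard tableau \<open>t\<close> whose shape has size \<open>k\<close>.\<close>

definition last_index :: "multipartition \<Rightarrow> tableau \<Rightarrow> nat" where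
  "last_index \<Lambda> t =
    (THE j. j \<in> {1..mp_size \<Lambda>} \<and>
            position \<Lambda> t (mp_size \<Lambda>) = position \<Lambda> (initial_tableau \<Lambda>) j)"


section \<open>The cyclotomic Hecke algebra\<close>

definition unit_inverse :: "'r::comm_ring_1 \<Rightarrow> 'r" where
  "unit_inverse q = (THE r. q * r = 1)"

text \<open>Only the values \<open>Q 1, \<dots>, Q ell\<close> are used.\<close>

locale cyclotomic_hecke =
  fixes ell n :: nat and q :: "'r::idom" and Q :: "nat \<Rightarrow> 'r"
begin

definition relators :: "'r free_alg set" where
  "relators =
     {\<Prod>i\<leftarrow>[1..<Suc ell]. (free_var 0 - free_const (Q i))}
   \<union> (if 1 < n then {free_var 0 * free_var 1 * free_var 0 * free_var 1
                    - free_var 1 * free_var 0 * free_var 1 * free_var 0} else {})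
   \<union> {(free_var i - free_const q) * (free_var i + 1) | i. 1 \<le> i \<and> i < n}
   \<union> {free_var i * free_var j - free_var j * free_var i | i j. i + 1 < j \<and> j < n}
   \<union> {free_var i * free_var (i + 1) * free_var i
        - free_var (i + 1) * free_var i * free_var (i + 1) | i. 1 \<le> i \<and> i + 1 < n}"

definition rel_ideal :: "'r free_alg set" where
  "rel_ideal = genideal (free_algebra n) relators"

definition hecke :: "('r free_alg set) ring" where
  "hecke = free_algebra n Quot rel_ideal"

definition to_hecke :: "'r free_alg \<Rightarrow> 'r free_alg set" where
  "to_hecke a = a_r_coset (free_algebra n) rel_ideal a"

definition T :: "nat \<Rightarrow> 'r free_alg set" where
  "T i = to_hecke (free_var i)"

definition scalar :: "'r \<Rightarrow> 'r free_alg set" where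
  "scalar r = to_hecke (free_const r)"

definition lprod :: "'r free_alg set list \<Rightarrow> 'r free_alg set" where
  "lprod xs = foldr (monoid.mult hecke) xs \<one>\<^bsub>hecke\<^esub>"

text \<open>The value at \<open>0\<close> is irrelevant.\<close>

fun jucys_murphy :: "nat \<Rightarrow> 'r free_alg set" where
  "jucys_murphy 0 = \<one>\<^bsub>hecke\<^esub>"
| "jucys_murphy (Suc 0) = T 0"
| "jucys_murphy (Suc (Suc k)) =
     scalar (unit_inverse q) \<otimes>\<^bsub>hecke\<^esub> T (Suc k) \<otimes>\<^bsub>hecke\<^esub> jucys_murphy (Suc k) \<otimes>\<^bsub>hecke\<^esub> T (Suc k)"

text \<open>By Matsumoto's theorem the choice of the reduced expression does not matter.\<close>

definition T_perm :: "(nat \<Rightarrow> nat) \<Rightarrow> 'r free_alg set" where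
  "T_perm w = lprod (map T (SOME is. reduced_expression n w is))"

text \<open>
  Reversal of words descends to the quotient; see \<open>star_anti_automorphism\<close> below.
\<close>

definition free_rev :: "'r free_alg \<Rightarrow> 'r free_alg" where
  "free_rev p = Poly_Mapping.map_key (\<lambda>w. Word (rev (letters w))) p"

definition star :: "'r free_alg set \<Rightarrow> 'r free_alg set" where
  "star X = free_rev ` X"

definition ariki_koike :: "(nat \<Rightarrow> nat) \<Rightarrow> (nat \<Rightarrow> nat) \<Rightarrow> 'r free_alg set" where
  "ariki_koike c w =
     lprod (map (\<lambda>i. jucys_murphy i [^]\<^bsub>hecke\<^esub> c i) [1..<Suc n]) \<otimes>\<^bsub>hecke\<^esub> T_perm w"

text \<open>
  The elements \<open>ariki_koike c w\<close> with \<open>w\<close>, \<open>c\<close> as below form a basis of the algebra, by a theorem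
  of Ariki and Koike, so this determines \<open>\<tau>\<close> on the carrier of \<open>hecke\<close>, and such a \<open>\<tau>\<close> exists.
\<close>

definition standard_form :: "('r free_alg set \<Rightarrow> 'r) \<Rightarrow> bool" where
  "standard_form \<tau> \<longleftrightarrow>
     (\<forall>x\<in>carrier hecke. \<forall>y\<in>carrier hecke. \<tau> (x \<oplus>\<^bsub>hecke\<^esub> y) = \<tau> x + \<tau> y) \<and>
     (\<forall>r. \<forall>x\<in>carrier hecke. \<tau> (scalar r \<otimes>\<^bsub>hecke\<^esub> x) = r * \<tau> x) \<and>
     (\<forall>c w. w permutes {1..n} \<and> (\<forall>i\<in>{1..n}. c i \<le> ell - 1) \<longrightarrow>
        \<tau> (ariki_koike c w) = (if w = id \<and> (\<forall>i\<in>{1..n}. c i = 0) then 1 else 0))"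

definition x_elt :: "multipartition \<Rightarrow> 'r free_alg set" where
  "x_elt \<Lambda> = (\<Oplus>\<^bsub>hecke\<^esub>w\<in>young_subgroup (concat \<Lambda>). T_perm w)"

definition u_elt :: "multipartition \<Rightarrow> 'r free_alg set" where
  "u_elt \<Lambda> =
     lprod (concat (map (\<lambda>s. map (\<lambda>k. jucys_murphy k \<ominus>\<^bsub>hecke\<^esub> scalar (Q s))
                                    [1..<Suc (mp_size (take (s - 1) \<Lambda>))])
                        [2..<Suc ell]))"

definition murphy :: "multipartition \<Rightarrow> tableau \<Rightarrow> tableau \<Rightarrow> 'r free_alg set" where
  "murphy \<Lambda> s t =
     star (T_perm (tableau_perm \<Lambda> s)) \<otimes>\<^bsub>hecke\<^esub> (x_elt \<Lambda> \<otimes>\<^bsub>hecke\<^esub> u_elt \<Lambda>) \<otimes>\<^bsub>hecke\<^esub> T_perm (tableau_perm \<Lambda> t)"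

subsection \<open>The anti-automorphism\<close>

lemma ring_free_algebra: "ring (free_algebra n :: ('r free_alg) ring)"
proof -
  have neg: "\<exists>y\<in>carrier (free_algebra n). y + x = 0" if "x \<in> carrier (free_algebra n)" for x :: "'r free_alg"
    using that by (intro bexI[of _ "- x"]) (auto simp: free_algebra_def)
  show ?thesis
  proof (rule ringI)
    show "abelian_group (free_algebra n :: ('r free_alg) ring)"
    proof (rule abelian_groupI)
      fix x y :: "'r free_alg"
      assume "x \<in> carrier (free_algebra n)" "y \<in> carrier (free_algebra n)"
      then show "x \<oplus>\<^bsub>free_algebra n\<^esub> y \<in> carrier (free_algebra n)"
        using Poly_Mapping.keys_add[of x y] by (auto simp: free_algebra_def)
    next
      fix x :: "'r free_alg"
      assume "x \<in> carrier (free_algebra n)"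
      then show "\<exists>y\<in>carrier (free_algebra n). y \<oplus>\<^bsub>free_algebra n\<^esub> x = \<zero>\<^bsub>free_algebra n\<^esub>"
        using neg by (simp add: free_algebra_def)
    qed (auto simp: free_algebra_def algebra_simps)
    show "Group.monoid (free_algebra n :: ('r free_alg) ring)"
    proof (rule monoidI)
      fix x y :: "'r free_alg"
      assume "x \<in> carrier (free_algebra n)" "y \<in> carrier (free_algebra n)"
      then show "x \<otimes>\<^bsub>free_algebra n\<^esub> y \<in> carrier (free_algebra n)"
        using keys_mult[of x y] by (fastforce simp: free_algebra_def plus_word_def)
    qed (auto simp: free_algebra_def zero_word_def mult.assoc)
  qed (auto simp: free_algebra_def algebra_simps)
qed

lemma free_var_carrier: "i < n \<Longrightarrow> free_var i \<in> carrier (free_algebra n)"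
  by (auto simp: free_algebra_def free_var_def)

lemma free_const_carrier: "free_const r \<in> carrier (free_algebra n)"
  by (auto simp: free_algebra_def free_const_def zero_word_def)

lemma free_algebra_closed:
  fixes x y :: "'r free_alg"
  assumes "x \<in> carrier (free_algebra n)" "y \<in> carrier (free_algebra n)"
  shows "x + y \<in> carrier (free_algebra n)" "x - y \<in> carrier (free_algebra n)"
    "x * y \<in> carrier (free_algebra n)" "- x \<in> carrier (free_algebra n)"
    "1 \<in> carrier (free_algebra n :: ('r free_alg) ring)"
    "0 \<in> carrier (free_algebra n :: ('r free_alg) ring)"
proof -
  interpret ring "free_algebra n :: ('r free_alg) ring" by (rule ring_free_algebra)
  show "x + y \<in> carrier (free_algebra n)" "x * y \<in> carrier (free_algebra n)"
    "1 \<in> carrier (free_algebra n :: ('r free_alg) ring)"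
    "0 \<in> carrier (free_algebra n :: ('r free_alg) ring)"
    using assms a_closed[of x y] m_closed[of x y] one_closed zero_closed
    by (simp_all add: free_algebra_def)
  show "x - y \<in> carrier (free_algebra n)" "- x \<in> carrier (free_algebra n)"
    using assms keys_diff[of x y] by (auto simp: free_algebra_def)
qed

lemma inj_word_rev: "inj (\<lambda>w. Word (rev (letters w)))"
  by (rule injI) (simp add: word.expand)

lemma free_rev_add: "free_rev (x + y) = free_rev x + free_rev y"
  by (simp add: free_rev_def map_key_plus[OF inj_word_rev])

lemma free_rev_zero: "free_rev 0 = 0"
  by (simp add: free_rev_def map_key_zero[OF inj_word_rev])

lemma free_rev_uminus: "free_rev (- x) = - free_rev x"
  using free_rev_add[of x "- x"] by (simp add: free_rev_zero eq_neg_iff_add_eq_0 add.commute)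

lemma free_rev_diff: "free_rev (x - y) = free_rev x - free_rev y"
  using free_rev_add[of x "- y"] by (simp add: free_rev_uminus)

lemma free_rev_single: "free_rev (Poly_Mapping.single w r) = Poly_Mapping.single (Word (rev (letters w))) r"
  using map_key_single[OF inj_word_rev, of "Word (rev (letters w))" r] by (simp add: free_rev_def)

lemma free_rev_free_rev: "free_rev (free_rev x) = x"
  by (simp add: free_rev_def map_key_compose[OF inj_word_rev inj_word_rev] o_def map_key_id)

lemma free_rev_free_var: "free_rev (free_var i) = free_var i"
  by (simp add: free_var_def free_rev_single)

lemma free_rev_free_const: "free_rev (free_const r) = free_const r"
  by (simp add: free_const_def free_rev_single zero_word_def)

lemma free_rev_one: "free_rev 1 = 1"
  using free_rev_free_const[of 1] by (simp add: free_const_def)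

lemma free_alg_induct [case_names zero add]:
  fixes p :: "'r free_alg"
  assumes "P 0" and "\<And>w r p. P p \<Longrightarrow> P (Poly_Mapping.single w r + p)"
  shows "P p"
proof (induction p rule: update_induct)
  case (update f a b)
  have "Poly_Mapping.update a b f = Poly_Mapping.single a b + f"
    using update(1)
    by (intro poly_mapping_eqI) (auto simp: lookup_update lookup_add lookup_single when_def in_keys_iff)
  then show ?case using assms(2)[OF update(3)] by simp
qed (rule assms(1))

lemma free_rev_mult: "free_rev (x * y) = free_rev y * free_rev x"
proof (induction x rule: free_alg_induct)
  case (add w r x)
  have "free_rev (Poly_Mapping.single w r * y) = free_rev y * free_rev (Poly_Mapping.single w r)"
  proof (induction y rule: free_alg_induct)
    case (add v s y)
    have "free_rev (Poly_Mapping.single w r * Poly_Mapping.single v s) =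
        free_rev (Poly_Mapping.single v s) * free_rev (Poly_Mapping.single w r)"
      by (simp add: mult_single free_rev_single plus_word_def mult.commute)
    with add show ?case by (simp add: algebra_simps free_rev_add)
  qed (simp add: free_rev_zero)
  with add show ?case by (simp add: algebra_simps free_rev_add)
qed (simp add: free_rev_zero)

lemma free_const_central:
  fixes x :: "'r free_alg"
  shows "free_const r * x = x * free_const r"
  by (induction x rule: free_alg_induct)
     (simp_all add: algebra_simps free_const_def mult_single mult.commute)

lemma free_rev_carrier:
  assumes "x \<in> carrier (free_algebra n)"
  shows "free_rev x \<in> carrier (free_algebra n)"
proof -
  have "w \<in> Poly_Mapping.keys (free_rev x) \<longleftrightarrow> Word (rev (letters w)) \<in> Poly_Mapping.keys x" for w
    by (simp add: free_rev_def keys_map_key[OF inj_word_rev])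
  with assms show ?thesis by (fastforce simp: free_algebra_def)
qed

lemma prod_list_commute:
  fixes x :: "'r free_alg"
  assumes "\<And>y. y \<in> set ys \<Longrightarrow> x * y = y * x"
  shows "x * prod_list ys = prod_list ys * x"
  using assms
proof (induction ys)
  case (Cons y ys)
  have "x * prod_list (y # ys) = (x * y) * prod_list ys" by (simp add: mult.assoc)
  also have "\<dots> = y * (x * prod_list ys)" using Cons.prems by (simp add: mult.assoc)
  also have "\<dots> = y * (prod_list ys * x)" using Cons by simp
  finally show ?case by (simp add: mult.assoc)
qed simp

lemma prod_list_rev:
  fixes ys :: "'r free_alg list"
  assumes "\<And>x y. x \<in> set ys \<Longrightarrow> y \<in> set ys \<Longrightarrow> x * y = y * x"
  shows "prod_list (rev ys) = prod_list ys"
  using assms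
proof (induction ys)
  case (Cons y ys)
  have "prod_list (rev (y # ys)) = prod_list ys * y" using Cons by simp
  also have "\<dots> = y * prod_list ys" by (rule prod_list_commute[symmetric]) (use Cons in auto)
  finally show ?case by simp
qed simp

lemma free_rev_prod_list: "free_rev (prod_list ys) = prod_list (rev (map free_rev ys))"
  by (induction ys) (simp_all add: free_rev_one free_rev_mult)

lemma free_rev_cyclotomic:
  "free_rev (\<Prod>i\<leftarrow>is. (free_var 0 - free_const (Q i))) = (\<Prod>i\<leftarrow>is. (free_var 0 - free_const (Q i)))"
proof -
  have "free_rev (\<Prod>i\<leftarrow>is. (free_var 0 - free_const (Q i))) =
      prod_list (rev (map (\<lambda>i. free_var 0 - free_const (Q i)) is))"
    by (simp add: free_rev_prod_list o_def free_rev_diff free_rev_free_var free_rev_free_const)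
  also have "\<dots> = (\<Prod>i\<leftarrow>is. (free_var 0 - free_const (Q i)))"
  proof (rule prod_list_rev, clarsimp)
    fix i j
    show "(free_var 0 - free_const (Q i)) * (free_var 0 - free_const (Q j)) =
          (free_var 0 - free_const (Q j)) * (free_var 0 - free_const (Q i))"
      by (simp add: algebra_simps free_const_central[of _ "free_var 0"]
          free_const_central[of "Q i" "free_const (Q j)"])
  qed
  finally show ?thesis .
qed

lemma relators_carrier:
  assumes "n \<ge> 1"
  shows "relators \<subseteq> carrier (free_algebra n)"
proof -
  have "(\<Prod>i\<leftarrow>is. (free_var 0 - free_const (Q i))) \<in> carrier (free_algebra n)" for "is"
    using assms
    by (induction "is") (auto intro!: free_algebra_closed free_var_carrier free_const_carrier)
  then show ?thesis
    using assms unfolding relators_def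
    by (auto intro!: free_algebra_closed free_var_carrier free_const_carrier)
qed

lemma free_rev_relators:
  assumes "x \<in> relators"
  shows "free_rev x = x \<or> free_rev x = - x"
proof -
  have 1: "(free_var i + 1) * (free_var i - free_const q) = (free_var i - free_const q) * (free_var i + 1)" for i
    by (simp add: algebra_simps free_const_central)
  show ?thesis
    using assms unfolding relators_def
    by (auto simp: free_rev_cyclotomic free_rev_add free_rev_diff free_rev_mult free_rev_free_var
        free_rev_free_const free_rev_one mult.assoc 1 simp del: upt_Suc split: if_splits)
qed

lemma ideal_rel_ideal:
  assumes "n \<ge> 1"
  shows "ideal rel_ideal (free_algebra n)"
  unfolding rel_ideal_def
  by (rule ring.genideal_ideal[OF ring_free_algebra relators_carrier[OF assms]])

lemma free_rev_rel_ideal: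
  assumes "n \<ge> 1" "x \<in> rel_ideal"
  shows "free_rev x \<in> rel_ideal"
proof -
  let ?F = "free_algebra n :: ('r free_alg) ring"
  let ?J = "{x \<in> carrier ?F. free_rev x \<in> rel_ideal}"
  interpret I: ideal rel_ideal ?F by (rule ideal_rel_ideal[OF assms(1)])
  have neg: "- x \<in> rel_ideal" if "x \<in> rel_ideal" for x
  proof -
    have "- 1 \<in> carrier ?F" using free_algebra_closed(4)[OF I.one_closed I.one_closed]
      by (simp add: free_algebra_def)
    from I.I_l_closed[OF that this] show ?thesis by (simp add: free_algebra_def)
  qed
  have add: "x + y \<in> rel_ideal" if "x \<in> rel_ideal" "y \<in> rel_ideal" for x y
    using I.additive_subgroup_axioms[THEN additive_subgroup.a_closed, OF that] by (simp add: free_algebra_def)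
  have zero: "0 \<in> rel_ideal" using I.additive_subgroup_axioms[THEN additive_subgroup.zero_closed] by (simp add: free_algebra_def)
  have ml: "y * x \<in> rel_ideal" "x * y \<in> rel_ideal" if "x \<in> rel_ideal" "y \<in> carrier ?F" for x y
    using I.I_l_closed[OF that] I.I_r_closed[OF that] by (simp_all add: free_algebra_def)
  have invF: "inv\<^bsub>add_monoid ?F\<^esub> x = - x" if "x \<in> carrier ?F" for x
  proof -
    have "- x \<in> carrier ?F" using free_algebra_closed(4)[OF that that] .
    then have "\<ominus>\<^bsub>?F\<^esub> x = - x"
      using that by (intro I.minus_equality) (auto simp: free_algebra_def)
    then show ?thesis by (simp add: a_inv_def)
  qed
  have "ideal ?J ?F"
  proof (rule idealI[OF ring_free_algebra])
    show "subgroup ?J (add_monoid ?F)"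
    proof
      fix x y assume "x \<in> ?J" "y \<in> ?J"
      then show "x \<otimes>\<^bsub>add_monoid ?F\<^esub> y \<in> ?J"
        using free_algebra_closed(1)[of x y] add
        by (simp add: free_algebra_def free_rev_add)
    next
      show "\<one>\<^bsub>add_monoid ?F\<^esub> \<in> ?J"
        using zero by (simp add: free_algebra_def free_rev_zero)
    next
      fix x assume x: "x \<in> ?J"
      then have "- x \<in> ?J"
        using free_algebra_closed(4)[of x x] neg by (simp add: free_rev_uminus)
      with x show "inv\<^bsub>add_monoid ?F\<^esub> x \<in> ?J"
        using invF[of x] by (simp only: mem_Collect_eq)
    qed simp
  next
    fix a x assume a: "a \<in> ?J" "x \<in> carrier ?F"
    then have "x * a \<in> ?J" "a * x \<in> ?J"
      using free_algebra_closed(3) ml free_rev_carrier[of x] by (simp_all add: free_rev_mult)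
    then show "x \<otimes>\<^bsub>?F\<^esub> a \<in> ?J" "a \<otimes>\<^bsub>?F\<^esub> x \<in> ?J"
      by (simp_all add: free_algebra_def)
  qed
  moreover have "relators \<subseteq> ?J"
  proof
    fix x assume x: "x \<in> relators"
    then have "x \<in> rel_ideal"
      using I.genideal_self[OF relators_carrier[OF assms(1)]] by (auto simp: rel_ideal_def)
    then show "x \<in> ?J"
      using free_rev_relators[OF x] neg[of x] relators_carrier[OF assms(1)] x by auto
  qed
  ultimately have "rel_ideal \<subseteq> ?J"
    unfolding rel_ideal_def[symmetric]
    using I.genideal_minimal[of ?J relators] by (simp add: rel_ideal_def)
  with assms(2) show ?thesis by blast
qed

lemma star_to_hecke:
  assumes "n \<ge> 1"
  shows "star (to_hecke a) = to_hecke (free_rev a)"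
proof -
  have coset: "to_hecke a = (\<lambda>h. h + a) ` rel_ideal" for a
    by (auto simp: to_hecke_def a_r_coset_def r_coset_def free_algebra_def)
  have "free_rev ` rel_ideal = rel_ideal"
    proof (intro equalityI subsetI)
    fix x assume "x \<in> rel_ideal"
    then show "x \<in> free_rev ` rel_ideal"
      using free_rev_rel_ideal[OF assms] by (intro image_eqI[of _ _ "free_rev x"]) (simp_all add: free_rev_free_rev)
  qed (use free_rev_rel_ideal[OF assms] in auto)
  then have "(\<lambda>h. h + free_rev a) ` rel_ideal = (\<lambda>h. h + free_rev a) ` free_rev ` rel_ideal" by simp
  then show ?thesis
    by (simp add: coset star_def image_image free_rev_add)
qed

theorem star_anti_automorphism:
  assumes "n \<ge> 1"
  shows "bij_betw star (carrier hecke) (carrier hecke)"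
    and "\<And>x y. x \<in> carrier hecke \<Longrightarrow> y \<in> carrier hecke \<Longrightarrow>
           star (x \<oplus>\<^bsub>hecke\<^esub> y) = star x \<oplus>\<^bsub>hecke\<^esub> star y"
    and "\<And>x y. x \<in> carrier hecke \<Longrightarrow> y \<in> carrier hecke \<Longrightarrow>
           star (x \<otimes>\<^bsub>hecke\<^esub> y) = star y \<otimes>\<^bsub>hecke\<^esub> star x"
    and "\<And>r. star (scalar r) = scalar r"
    and "\<And>i. i < n \<Longrightarrow> star (T i) = T i"
proof -
  let ?F = "free_algebra n :: ('r free_alg) ring"
  interpret I: ideal rel_ideal ?F by (rule ideal_rel_ideal[OF assms])
  have hom: "to_hecke \<in> ring_hom ?F hecke"
    using I.rcos_ring_hom by (simp add: to_hecke_def[abs_def] hecke_def)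
  have carr: "carrier hecke = to_hecke ` carrier ?F"
    by (auto simp: hecke_def FactRing_def A_RCOSETS_def' to_hecke_def)
  note st = star_to_hecke[OF assms]
  have inv: "star (star x) = x" for x
    by (simp add: star_def image_image free_rev_free_rev)
  have "star x \<in> carrier hecke" if "x \<in> carrier hecke" for x
    using that by (auto simp: carr st free_rev_carrier)
  then show "bij_betw star (carrier hecke) (carrier hecke)"
    by (intro bij_betwI[of _ _ _ star]) (auto simp: inv)
  fix x y assume "x \<in> carrier hecke" "y \<in> carrier hecke"
  then obtain a b where ab: "a \<in> carrier ?F" "b \<in> carrier ?F" "x = to_hecke a" "y = to_hecke b"
    by (auto simp: carr)
  note ab' = free_rev_carrier[OF ab(1)] free_rev_carrier[OF ab(2)]
  show "star (x \<oplus>\<^bsub>hecke\<^esub> y) = star x \<oplus>\<^bsub>hecke\<^esub> star y"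
  proof -
    have "star (x \<oplus>\<^bsub>hecke\<^esub> y) = star (to_hecke (a \<oplus>\<^bsub>?F\<^esub> b))"
      using ring_hom_add[OF hom ab(1,2)] ab by simp
    also have "\<dots> = to_hecke (free_rev a \<oplus>\<^bsub>?F\<^esub> free_rev b)"
      by (simp add: st free_rev_add free_algebra_def)
    finally show ?thesis using ring_hom_add[OF hom ab'] by (simp add: ab st)
  qed
  show "star (x \<otimes>\<^bsub>hecke\<^esub> y) = star y \<otimes>\<^bsub>hecke\<^esub> star x"
  proof -
    have "star (x \<otimes>\<^bsub>hecke\<^esub> y) = star (to_hecke (a \<otimes>\<^bsub>?F\<^esub> b))"
      using ring_hom_mult[OF hom ab(1,2)] ab by simp
    also have "\<dots> = to_hecke (free_rev b \<otimes>\<^bsub>?F\<^esub> free_rev a)"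
      by (simp add: st free_rev_mult free_algebra_def)
    finally show ?thesis using ring_hom_mult[OF hom ab'(2) ab'(1)] by (simp add: ab st)
  qed
next
  show "star (scalar r) = scalar r" for r
    by (simp add: scalar_def star_to_hecke[OF assms] free_rev_free_const)
  show "star (T i) = T i" for i
    by (simp add: T_def star_to_hecke[OF assms] free_rev_free_var)
qed

end

end

theory Submission
  imports Defs
begin

text \<open>
  Moving \<open>T i\<close> past a monomial in the Jucys--Murphy elements keeps the total degree and does not
  raise the maximal exponent. Hence in \<open>\<tau> (T v \<cdot> u \<cdot> T w)\<close>, with \<open>u\<close> a polynomial in the Jucys--Murphy
  elements of degree less than \<open>ell\<close> in each, only the constant term of \<open>u\<close> contributes. For the
  factor \<open>u\<close> of the Murphy element that constant term is the product of the \<open>- Q i\<close>, and what remains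
  is a computation in the Hecke algebra of the symmetric group. As \<open>d(t)\<close> increases along rows,
  multiplying \<open>x\<close> by \<open>T d(t)\<close> gives the sum of the \<open>T w\<close> over the coset of \<open>d(t)\<close>, and \<open>d(s)\<close> lies
  in that coset only if \<open>s = t\<close>. This leaves \<open>q\<close> to the number of inversions of \<open>d(t)\<close>, of which
  \<open>k - k(t)\<close>, for the subtableau of entries at most \<open>k\<close>, counts those with larger value \<open>k\<close>.
\<close>

section \<open>Inversions and words\<close>

text \<open>In the Ariki--Koike basis the monomials stand to the left, whereas in a Murphy element
  the factor \<open>u\<close> has generators on both sides. Those to its right do no harm; those to
  its left must be carried through it, and the corrections would leave the basis if an exponent
  reached \<open>ell\<close>. Two facts prevent this: \<open>T i\<close> commutes with
  \<open>L i \<otimes> L (Suc i)\<close>, so that only the excess of one exponent over the other is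
  really moved, and \<open>u\<close> contains each \<open>L k\<close> at most once for every
  parameter index from 2 to \<open>ell\<close>, hence at most \<open>ell - 1\<close> times. The
  power of \<open>q\<close> comes from the constant term of \<open>T i \<otimes> T i = (q - 1)
  \<bullet> T i \<oplus> q \<bullet> \<one>\<close>: when a reduced word meets its reversal, every
  letter cancels against itself and leaves one factor \<open>q\<close>. Lengths are treated as
  numbers of inversions throughout. This turns reducedness into a condition on ascents, and it is
  also the form in which the exponent of the theorem is recovered from the tableau.\<close>

definition inversions :: "nat \<Rightarrow> (nat \<Rightarrow> nat) \<Rightarrow> (nat \<times> nat) set" where
  "inversions n w = {(a, b). 1 \<le> a \<and> a < b \<and> b \<le> n \<and> w b < w a}"

definition inv_count :: "nat \<Rightarrow> (nat \<Rightarrow> nat) \<Rightarrow> nat" where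
  "inv_count n w = card (inversions n w)"

lemma finite_inversions [simp]: "finite (inversions n w)"
  by (rule finite_subset[of _ "{1..n} \<times> {1..n}"]) (auto simp: inversions_def)

lemma transpose_permutes:
  assumes "1 \<le> i" "i < n"
  shows "transpose i (Suc i) permutes {1..n}"
  by (rule permutes_swap_id) (use assms in auto)

text \<open>With the right action, a letter put in front of a word exchanges two adjacent positions.
  The exchange keeps the order of every pair of positions except \<open>(i, Suc i)\<close>, so all
  other inversions are merely relabelled, and at an ascent this one pair is added.\<close>

lemma inversions_ascent:
  assumes "1 \<le> i" "i < n" "w i < w (Suc i)"
  shows "inversions n (w \<circ> transpose i (Suc i)) =
    insert (i, Suc i) (map_prod (transpose i (Suc i)) (transpose i (Suc i)) ` inversions n w)"
    (is "?L = insert _ (?f ` _)")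
proof (intro equalityI subsetI)
  fix p assume "p \<in> ?L"
  then obtain a b where p: "p = (a, b)" "1 \<le> a" "a < b" "b \<le> n"
    "w (transpose i (Suc i) b) < w (transpose i (Suc i) a)"
    by (auto simp: inversions_def)
  show "p \<in> insert (i, Suc i) (?f ` inversions n w)"
  proof (cases "a = i \<and> b = Suc i")
    case False
    then have "(transpose i (Suc i) a, transpose i (Suc i) b) \<in> inversions n w"
      using p assms by (auto simp: inversions_def transpose_def split: if_splits)
    then have "?f (transpose i (Suc i) a, transpose i (Suc i) b) \<in> ?f ` inversions n w"
      by blast
    then show ?thesis using p by simp
  qed (use p in simp)
next
  fix p assume "p \<in> insert (i, Suc i) (?f ` inversions n w)"
  then consider "p = (i, Suc i)"
    | a b where "1 \<le> a" "a < b" "b \<le> n" "w b < w a"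
        "p = (transpose i (Suc i) a, transpose i (Suc i) b)"
    by (auto simp: inversions_def)
  then show "p \<in> ?L"
  proof cases
    case 2
    moreover have "\<not> (a = i \<and> b = Suc i)"
      using 2 assms by auto
    ultimately show ?thesis
      using assms by (auto simp: inversions_def transpose_def)
  qed (use assms in \<open>auto simp: inversions_def\<close>)
qed

lemma inv_count_ascent:
  assumes "1 \<le> i" "i < n" "w i < w (Suc i)"
  shows "inv_count n (w \<circ> transpose i (Suc i)) = Suc (inv_count n w)"
proof -
  let ?s = "transpose i (Suc i)"
  have "inj (map_prod ?s ?s)"
    by (intro prod.inj_map) auto
  then have "card (map_prod ?s ?s ` inversions n w) = inv_count n w"
    by (simp add: inv_count_def card_image inj_on_subset)
  moreover have "(i, Suc i) \<notin> map_prod ?s ?s ` inversions n w"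
    by (auto simp: inversions_def transpose_def split: if_splits)
  ultimately show ?thesis
    by (simp add: inversions_ascent[OF assms] inv_count_def)
qed

lemma inv_count_descent:
  assumes "1 \<le> i" "i < n" "w (Suc i) < w i"
  shows "Suc (inv_count n (w \<circ> transpose i (Suc i))) = inv_count n w"
  using inv_count_ascent[of i n "w \<circ> transpose i (Suc i)"] assms
  by (simp add: comp_assoc)

lemma permutes_ascent_or_descent:
  assumes "w permutes S"
  shows "w i < w (Suc i) \<or> w (Suc i) < w (i::nat)"
  using injD[OF permutes_inj[OF assms], of i "Suc i"] by (metis n_not_Suc_n nat_neq_iff)

lemma inv_count_id [simp]: "inv_count n id = 0"
proof -
  have "inversions n id = {}" by (auto simp: inversions_def)
  then show ?thesis by (simp add: inv_count_def)
qed

lemma perm_of_word_permutes: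
  "set is \<subseteq> {1..<n} \<Longrightarrow> perm_of_word is permutes {1..n}"
proof (induction "is")
  case (Cons i "is")
  then show ?case
    using permutes_compose[OF transpose_permutes[of i n], of "perm_of_word is"]
    by (simp del: o_apply add: o_def)
qed (simp add: permutes_id)

lemma inv_count_perm_of_word_le:
  "set is \<subseteq> {1..<n} \<Longrightarrow> inv_count n (perm_of_word is) \<le> length is"
proof (induction "is")
  case (Cons i "is")
  then show ?case
    using permutes_ascent_or_descent[OF perm_of_word_permutes, of "is" n i]
      inv_count_ascent[of i n "perm_of_word is"] inv_count_descent[of i n "perm_of_word is"]
    by (auto simp: o_def)
qed simp

text \<open>Monotonicity gives \<open>i \<le> w i\<close> for every \<open>i\<close>; since
  \<open>w\<close> permutes the range, both sides have the same sum, so all these inequalities are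
  equalities.\<close>

lemma strict_mono_permutes_id:
  assumes w: "w permutes {1..n::nat}" and mono: "\<And>i. 1 \<le> i \<Longrightarrow> i < n \<Longrightarrow> w i < w (Suc i)"
  shows "w = id"
proof -
  have lower: "i \<le> w i" if "i \<in> {1..n}" for i
  proof -
    have "1 \<le> i" "i \<le> n" using that by auto
    then show ?thesis
    proof (induction i rule: dec_induct)
      case base
      then show ?case using permutes_in_image[OF w, of 1] by simp
    next
      case (step i)
      then show ?case using mono[of i] by simp
    qed
  qed
  have "(\<Sum>i=1..n. w i) = (\<Sum>i=1..n. i)"
    using sum.permute[OF w, of "\<lambda>i. i"] by (simp add: o_def)
  then have "(\<Sum>i=1..n. w i - i) = 0"
    using sum_subtractf_nat[of "{1..n}" "\<lambda>i. i" w] lower by simp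
  then have "w i = i" if "i \<in> {1..n}" for i
    using that lower[of i] by (auto simp: le_antisym)
  moreover have "w i = i" if "i \<notin> {1..n}" for i
    using permutes_not_in[OF w that] .
  ultimately show ?thesis by (auto simp: fun_eq_iff)
qed

text \<open>Removing a descent lowers the count by one, and only the identity has no descent. With
  \<open>inv_count_perm_of_word_le\<close> this identifies the minimal length of a word with the
  number of inversions.\<close>

lemma ex_word_inv_count:
  assumes "w permutes {1..n}"
  shows "\<exists>is. set is \<subseteq> {1..<n} \<and> perm_of_word is = w \<and> length is = inv_count n w"
  using assms
proof (induction "inv_count n w" arbitrary: w)
  case 0
  have "w i < w (Suc i)" if "1 \<le> i" "i < n" for i
    using that 0 permutes_ascent_or_descent[OF 0(2), of i] inv_count_descent[of i n w] by auto
  then have "w = id" using strict_mono_permutes_id[OF 0(2)] by blast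
  then have "set [] \<subseteq> {1..<n} \<and> perm_of_word [] = w \<and> length [] = inv_count n w"
    using 0(1) by simp
  then show ?case by blast
next
  case (Suc k)
  have "\<exists>i. 1 \<le> i \<and> i < n \<and> w (Suc i) < w i"
  proof (rule ccontr)
    assume "\<not> ?thesis"
    then have "w = id"
      using strict_mono_permutes_id[OF Suc(3)] permutes_ascent_or_descent[OF Suc(3)] by blast
    with Suc(2) show False by simp
  qed
  then obtain i where i: "1 \<le> i" "i < n" "w (Suc i) < w i" by blast
  let ?v = "w \<circ> transpose i (Suc i)"
  have "k = inv_count n ?v" using inv_count_descent[OF i] Suc(2) by simp
  moreover have "?v permutes {1..n}"
    by (rule permutes_compose[OF transpose_permutes[OF i(1,2)] Suc(3)])
  ultimately obtain js where
    js: "set js \<subseteq> {1..<n}" "perm_of_word js = ?v" "length js = inv_count n ?v"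
    using Suc(1) by blast
  then show ?case
    using i inv_count_descent[OF i] by (intro exI[of _ "i # js"]) (auto simp: comp_assoc)
qed

text \<open>Comparing the length with a count, instead of with all other words, allows reducedness
  to be checked letter by letter.\<close>

definition reduced_word :: "nat \<Rightarrow> nat list \<Rightarrow> bool" where
  "reduced_word n is \<longleftrightarrow> set is \<subseteq> {1..<n} \<and> length is = inv_count n (perm_of_word is)"

lemma reduced_expression_iff:
  assumes "w permutes {1..n}"
  shows "reduced_expression n w is \<longleftrightarrow> reduced_word n is \<and> perm_of_word is = w"
  using ex_word_inv_count[OF assms] inv_count_perm_of_word_le[of _ n]
  unfolding reduced_expression_def reduced_word_def by (metis le_antisym)

lemma ex_reduced_word:
  assumes "w permutes {1..n}"
  obtains "is" where "reduced_word n is" "perm_of_word is = w"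
  using ex_word_inv_count[OF assms] by (auto simp: reduced_word_def)

lemma reduced_word_Nil [simp]: "reduced_word n []"
  by (simp add: reduced_word_def)

text \<open>If \<open>i\<close> were a descent of the tail, the whole word would have one inversion
  fewer than the tail, which itself has at most \<open>length is\<close>; that is too few for a
  reduced word of length \<open>Suc (length is)\<close>.\<close>

lemma reduced_word_Cons:
  "reduced_word n (i # is) \<longleftrightarrow>
    1 \<le> i \<and> i < n \<and> reduced_word n is \<and> perm_of_word is i < perm_of_word is (Suc i)"
proof
  assume *: "reduced_word n (i # is)"
  then have i: "1 \<le> i" "i < n" "set is \<subseteq> {1..<n}" by (auto simp: reduced_word_def)
  have "perm_of_word is i < perm_of_word is (Suc i)"
  proof (rule ccontr)
    assume "\<not> ?thesis"
    then have "perm_of_word is (Suc i) < perm_of_word is i"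
      using permutes_ascent_or_descent[OF perm_of_word_permutes[OF i(3)]] by blast
    then show False
      using inv_count_descent[OF i(1,2), of "perm_of_word is"] inv_count_perm_of_word_le[OF i(3)] *
      by (simp add: reduced_word_def)
  qed
  then show "1 \<le> i \<and> i < n \<and> reduced_word n is \<and> perm_of_word is i < perm_of_word is (Suc i)"
    using * i inv_count_ascent[OF i(1,2), of "perm_of_word is"] by (simp add: reduced_word_def)
next
  assume "1 \<le> i \<and> i < n \<and> reduced_word n is \<and> perm_of_word is i < perm_of_word is (Suc i)"
  then show "reduced_word n (i # is)"
    using inv_count_ascent[of i n "perm_of_word is"] by (auto simp: reduced_word_def)
qed

lemma reduced_word_Cons_descent:
  assumes "reduced_word n (i # is)"
  shows "perm_of_word (i # is) (Suc i) < perm_of_word (i # is) i"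
  using assms by (simp add: reduced_word_Cons)

section \<open>Words in a monoid satisfying the braid relations\<close>

text \<open>Matsumoto's theorem is a statement about words and braid relations only, hence the
  setting of a monoid. The index 0 takes part in the commutation relations here, since
  \<open>T 0\<close> must commute with the distant generators.\<close>

locale braid_monoid = Group.monoid G for G (structure) +
  fixes n :: nat and T :: "nat \<Rightarrow> 'a"
  assumes T_closed: "i < n \<Longrightarrow> T i \<in> carrier G"
    and T_commute: "i + 1 < j \<Longrightarrow> j < n \<Longrightarrow> T i \<otimes> T j = T j \<otimes> T i"
    and T_braid: "1 \<le> i \<Longrightarrow> i + 1 < n \<Longrightarrow>
      T i \<otimes> T (i + 1) \<otimes> T i = T (i + 1) \<otimes> T i \<otimes> T (i + 1)"
begin

definition T_word :: "nat list \<Rightarrow> 'a" where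
  "T_word is = foldr (\<otimes>) (map T is) \<one>"

lemma T_word_simps [simp]: "T_word [] = \<one>" "T_word (i # is) = T i \<otimes> T_word is"
  by (simp_all add: T_word_def)

lemma T_word_closed: "set is \<subseteq> {..<n} \<Longrightarrow> T_word is \<in> carrier G"
  by (induction "is") (auto simp: T_closed)

lemma T_word_append:
  "set is \<subseteq> {..<n} \<Longrightarrow> set js \<subseteq> {..<n} \<Longrightarrow> T_word (is @ js) = T_word is \<otimes> T_word js"
  by (induction "is") (auto simp: T_closed T_word_closed m_assoc)

lemma reduced_word_lessThan: "reduced_word n is \<Longrightarrow> set is \<subseteq> {..<n}"
  by (auto simp: reduced_word_def)

text \<open>
  Matsumoto's theorem in type A, in two steps. Here two descents \<open>i\<close>, \<open>j\<close> are joined through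
  reduced words that begin with the longest element of the subgroup they generate.
\<close>

lemma T_word_two_descents:
  assumes w: "w permutes {1..n}" and ij: "1 \<le> i" "i < j" "j < n"
    and desc: "w (Suc i) < w i" "w (Suc j) < w j"
  shows "\<exists>is js. reduced_word n (i # is) \<and> reduced_word n (j # js) \<and>
    perm_of_word (i # is) = w \<and> perm_of_word (j # js) = w \<and>
    T_word (i # is) = T_word (j # js)"
proof (cases "Suc i = j")
  case False
  let ?v = "w \<circ> transpose i (Suc i) \<circ> transpose j (Suc j)"
  have "?v permutes {1..n}"
    using ij by (intro permutes_compose[OF transpose_permutes] w) auto
  then obtain ks where ks: "reduced_word n ks" "perm_of_word ks = ?v"
    by (rule ex_reduced_word)
  have comm: "transpose i (Suc i) \<circ> transpose j (Suc j) = transpose j (Suc j) \<circ> transpose i (Suc i)"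
    using False ij by (auto simp: fun_eq_iff transpose_def)
  have v': "?v = w \<circ> transpose j (Suc j) \<circ> transpose i (Suc i)"
    by (simp add: comp_assoc comm)
  have 1: "perm_of_word (i # ks) = w \<circ> transpose j (Suc j)"
    using ks(2) unfolding v' by (simp add: comp_assoc)
  have 2: "perm_of_word (j # ks) = w \<circ> transpose i (Suc i)"
    using ks by (simp add: comp_assoc)
  have r1: "reduced_word n (i # ks)"
    using ij False desc ks(1) by (auto simp: reduced_word_Cons ks(2) transpose_def)
  have r2: "reduced_word n (j # ks)"
    using ij False desc ks(1) by (auto simp: reduced_word_Cons ks(2) transpose_def)
  have r3: "reduced_word n (i # j # ks)"
    unfolding reduced_word_Cons[of n i] 2
    using r2 ij desc by (simp add: transpose_def)
  have r4: "reduced_word n (j # i # ks)"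
    unfolding reduced_word_Cons[of n j] 1
    using r1 ij desc by (simp add: transpose_def)
  have "T i \<otimes> (T j \<otimes> T_word ks) = T j \<otimes> (T i \<otimes> T_word ks)"
    using ij False T_word_closed[OF reduced_word_lessThan[OF ks(1)]]
    using T_commute[of i j] by (simp add: m_assoc[symmetric] T_closed)
  moreover have "perm_of_word (i # j # ks) = w" "perm_of_word (j # i # ks) = w"
    using 1 2 by (simp_all add: comp_assoc)
  ultimately show ?thesis
    using r3 r4 by (intro exI[of _ "j # ks"] exI[of _ "i # ks"]) simp
next
  case True
  let ?si = "transpose i (Suc i)" and ?sj = "transpose j (Suc j)"
  \<comment> \<open>The two descents say that \<open>w\<close> decreases on \<open>i\<close>,
    \<open>i + 1\<close>, \<open>i + 2\<close>. Passing to \<open>?v\<close> reverses these three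
    values, so \<open>?v\<close> increases there, and the three letters can be put back in either
    order, each at an ascent.\<close>
  let ?v = "w \<circ> ?si \<circ> ?sj \<circ> ?si"
  have "?v permutes {1..n}"
    using ij by (intro permutes_compose[OF transpose_permutes] w) auto
  then obtain ks where ks: "reduced_word n ks" "perm_of_word ks = ?v"
    by (rule ex_reduced_word)
  have braid: "?si \<circ> ?sj \<circ> ?si = ?sj \<circ> ?si \<circ> ?sj"
    using True by (auto simp: fun_eq_iff transpose_def)
  have v': "?v = w \<circ> ?sj \<circ> ?si \<circ> ?sj"
    using braid by (simp add: comp_assoc)
  have p1: "perm_of_word (i # ks) = w \<circ> ?si \<circ> ?sj"
    using ks by (simp add: comp_assoc)
  have p2: "perm_of_word (j # i # ks) = w \<circ> ?si"
    using p1 by (simp add: comp_assoc)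
  have p3: "perm_of_word (i # j # i # ks) = w"
    using p2 by (simp add: comp_assoc)
  have p1': "perm_of_word (j # ks) = w \<circ> ?sj \<circ> ?si"
    using ks(2) unfolding v' by (simp add: comp_assoc)
  have p2': "perm_of_word (i # j # ks) = w \<circ> ?sj"
    using p1' by (simp add: comp_assoc)
  have p3': "perm_of_word (j # i # j # ks) = w"
    using p2' by (simp add: comp_assoc)
  have r1: "reduced_word n (i # ks)"
    using ij True desc ks(1) by (auto simp: reduced_word_Cons ks(2) transpose_def)
  have r2: "reduced_word n (j # i # ks)"
    unfolding reduced_word_Cons[of n j] p1
    using r1 ij True desc by (auto simp: transpose_def)
  have r3: "reduced_word n (i # j # i # ks)"
    unfolding reduced_word_Cons[of n i] p2
    using r2 ij True desc by (auto simp: transpose_def)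
  have r1': "reduced_word n (j # ks)"
    using ij True desc ks(1) by (auto simp: reduced_word_Cons ks(2) transpose_def)
  have r2': "reduced_word n (i # j # ks)"
    unfolding reduced_word_Cons[of n i] p1'
    using r1' ij True desc by (auto simp: transpose_def)
  have r3': "reduced_word n (j # i # j # ks)"
    unfolding reduced_word_Cons[of n j] p2'
    using r2' ij True desc by (auto simp: transpose_def)
  have "T i \<otimes> (T j \<otimes> (T i \<otimes> T_word ks)) = T j \<otimes> (T i \<otimes> (T j \<otimes> T_word ks))"
    using ij True T_word_closed[OF reduced_word_lessThan[OF ks(1)]] T_braid[of i]
    by (simp add: m_assoc[symmetric] T_closed)
  then show ?thesis
    using r3 r3' p3 p3' by (intro exI[of _ "j # i # ks"] exI[of _ "i # j # ks"]) simp
qed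

text \<open>The second step is an induction on the length. Words with the same first letter are
  compared through their tails. If the first letters differ, both are descents of the common
  permutation, and \<open>T_word_two_descents\<close> supplies two equal products, one beginning
  with each letter, that link the given words.\<close>

lemma T_word_cong:
  assumes "reduced_word n is" "reduced_word n js" "perm_of_word is = perm_of_word js"
  shows "T_word is = T_word js"
  using assms
proof (induction "length is" arbitrary: "is" js)
  case 0
  then have "length is = 0" "length js = 0"
    by (simp_all only: reduced_word_def)
  then show ?case by simp
next
  case (Suc k)
  then have len: "length is = Suc k" "length js = Suc k" by (simp_all add: reduced_word_def)
  obtain i is' j js' where eq: "is = i # is'" "js = j # js'"
    using len by (metis length_Suc_conv)
  let ?w = "perm_of_word is"
  have bounds: "1 \<le> i" "i < n" "1 \<le> j" "j < n"
    and red': "reduced_word n is'" "reduced_word n js'"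
    using Suc.prems by (auto simp: eq reduced_word_Cons)
  have desc: "?w (Suc i) < ?w i"
    using reduced_word_Cons_descent[of n i is'] Suc.prems(1) by (simp only: eq)
  have "perm_of_word js (Suc j) < perm_of_word js j"
    using reduced_word_Cons_descent[of n j js'] Suc.prems(2) by (simp only: eq)
  then have desc': "?w (Suc j) < ?w j"
    by (simp only: Suc.prems(3))
  have w: "?w permutes {1..n}"
    using Suc.prems(1) by (intro perm_of_word_permutes) (simp add: reduced_word_def)
  have cancel: "T_word (a # as) = T_word (a # bs)"
    if "reduced_word n (a # as)" "reduced_word n (a # bs)"
      "perm_of_word (a # as) = perm_of_word (a # bs)" "length (a # as) = Suc k" for a as bs
  proof -
    have "perm_of_word as = perm_of_word bs"
      using arg_cong[OF that(3), of "\<lambda>f. f \<circ> transpose a (Suc a)"] by (simp add: comp_assoc)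
    then show ?thesis
      using Suc.hyps(1)[of as bs] that by (simp add: reduced_word_Cons)
  qed
  show ?case
  proof (cases "i = j")
    case True
    then show ?thesis using cancel[of i is' js'] Suc.prems len by (simp add: eq)
  next
    case False
    have "\<exists>as bs. reduced_word n (i # as) \<and> reduced_word n (j # bs) \<and>
      perm_of_word (i # as) = ?w \<and> perm_of_word (j # bs) = ?w \<and> T_word (i # as) = T_word (j # bs)"
    proof (cases "i < j")
      case True
      then show ?thesis using T_word_two_descents[OF w _ True] bounds desc desc' by blast
    next
      case ge: False
      with False have "j < i" by simp
      from T_word_two_descents[OF w _ this] bounds desc desc'
      show ?thesis by metis
    qed
    then obtain as bs where *: "reduced_word n (i # as)" "reduced_word n (j # bs)"
      "perm_of_word (i # as) = ?w" "perm_of_word (j # bs) = ?w" "T_word (i # as) = T_word (j # bs)"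
      by blast
    have "T_word is = T_word (i # as)"
      using cancel[of i is' as] Suc.prems * len by (simp add: eq)
    also have "\<dots> = T_word (j # bs)" by (rule *)
    also have "\<dots> = T_word js"
      using cancel[of j js' bs] Suc.prems * len by (simp add: eq)
    finally show ?thesis .
  qed
qed

text \<open>The choice is literally the one made in \<open>T_perm\<close>, so that the two agree by
  unfolding.\<close>

definition T_of_perm :: "(nat \<Rightarrow> nat) \<Rightarrow> 'a" where
  "T_of_perm w = T_word (SOME is. reduced_expression n w is)"

lemma T_of_perm_eq:
  assumes "reduced_word n is"
  shows "T_of_perm (perm_of_word is) = T_word is"
proof -
  have w: "perm_of_word is permutes {1..n}"
    using assms by (intro perm_of_word_permutes) (simp add: reduced_word_def)
  have "\<exists>js. reduced_expression n (perm_of_word is) js"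
    using assms reduced_expression_iff[OF w] by blast
  from someI_ex[OF this] show ?thesis
    unfolding T_of_perm_def reduced_expression_iff[OF w]
    by (intro T_word_cong assms) (elim conjE, assumption)+
qed

lemma T_of_perm_closed:
  assumes "w permutes {1..n}"
  shows "T_of_perm w \<in> carrier G"
proof -
  obtain "is" where is': "reduced_word n is" "perm_of_word is = w"
    using ex_reduced_word[OF assms] by blast
  show ?thesis
    using T_of_perm_eq[OF is'(1)] T_word_closed[OF reduced_word_lessThan[OF is'(1)]]
    by (simp only: is'(2))
qed

lemma T_of_perm_id [simp]: "T_of_perm id = \<one>"
  using T_of_perm_eq[of "[]"] by simp

lemma T_mult_ascent:
  assumes "w permutes {1..n}" "1 \<le> i" "i < n" "w i < w (Suc i)"
  shows "T i \<otimes> T_of_perm w = T_of_perm (w \<circ> transpose i (Suc i))"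
proof -
  obtain "is" where is': "reduced_word n is" "perm_of_word is = w"
    using ex_reduced_word[OF assms(1)] by blast
  have "reduced_word n (i # is)"
    using assms is' by (simp add: reduced_word_Cons)
  from T_of_perm_eq[OF this] show ?thesis
    using T_of_perm_eq[OF is'(1)] is'(2) by simp
qed

text \<open>
  The hypothesis says that \<open>d\<close> increases on the values that \<open>w\<close> inverts, whence the lengths of
  \<open>w\<close> and \<open>d\<close> add up.
\<close>

lemma T_of_perm_mult:
  assumes d: "d permutes {1..n}" and w: "w permutes {1..n}"
    and "\<And>a b. a < b \<Longrightarrow> w b < w a \<Longrightarrow> d (w b) < d (w a)"
  shows "T_of_perm w \<otimes> T_of_perm d = T_of_perm (d \<circ> w)"
proof -
  obtain "is" where is': "reduced_word n is" "perm_of_word is = w"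
    using ex_reduced_word[OF w] by blast
  have "T_word is \<otimes> T_of_perm d = T_of_perm (d \<circ> perm_of_word is)"
    using is'(1) assms(3) unfolding is'(2)[symmetric]
  proof (induction "is")
    case (Cons i "is")
    let ?v = "perm_of_word is" and ?s = "transpose i (Suc i)"
    from Cons.prems(1) have i: "1 \<le> i" "i < n" "reduced_word n is" "?v i < ?v (Suc i)"
      by (simp_all add: reduced_word_Cons)
    \<comment> \<open>An inversion of the tail is not the pair \<open>(i, Suc i)\<close>, which is
      an ascent of it. The exchange therefore preserves the order of the pair and makes it an
      inversion of the longer word, to which the hypothesis applies.\<close>
    have less: "d (?v b) < d (?v a)" if "a < b" "?v b < ?v a" for a b
    proof -
      have "?s a < ?s b"
        using that i(4) by (auto simp: transpose_def split: if_splits)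
      then show ?thesis
        using Cons.prems(2)[of "?s a" "?s b"] that by simp
    qed
    have v: "?v permutes {1..n}"
      using i by (intro perm_of_word_permutes) (simp add: reduced_word_def)
    have "T_word (i # is) \<otimes> T_of_perm d = T i \<otimes> (T_word is \<otimes> T_of_perm d)"
      using i d by (simp add: m_assoc T_closed T_word_closed[OF reduced_word_lessThan] T_of_perm_closed)
    also have "\<dots> = T i \<otimes> T_of_perm (d \<circ> ?v)"
      using Cons.IH[OF i(3) less] by (simp only:)
    also have "\<dots> = T_of_perm (d \<circ> ?v \<circ> ?s)"
      using Cons.prems(2)[of i "Suc i"] i
      by (intro T_mult_ascent permutes_compose[OF v d]) auto
    finally show ?case by (simp only: perm_of_word.simps comp_assoc)
  qed (use d in \<open>simp add: T_of_perm_closed\<close>)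
  then show ?thesis
    using T_of_perm_eq[OF is'(1)] is'(2) by simp
qed

end

section \<open>Jucys--Murphy elements\<close>

text \<open>The calculations need only identities between elements, so they are done in an abstract
  ring with central scalars rather than with cosets in the free algebra. The parameter
  \<open>q'\<close> stands for the inverse of \<open>q\<close> in the recursion for
  \<open>L\<close>.\<close>

locale hecke_relations = ring H + braid_monoid H n T
  for H (structure) and n :: nat and T :: "nat \<Rightarrow> 'a" +
  fixes q q' :: "'r::comm_ring_1" and sc :: "'r \<Rightarrow> 'a" and L :: "nat \<Rightarrow> 'a"
  assumes n_pos: "1 \<le> n"
    and q_inverse: "q * q' = 1"
    and sc_closed [simp]: "sc r \<in> carrier H"
    and sc_add: "sc (r + r') = sc r \<oplus> sc r'"
    and sc_mult: "sc (r * r') = sc r \<otimes> sc r'"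
    and sc_one: "sc 1 = \<one>"
    and sc_central: "x \<in> carrier H \<Longrightarrow> x \<otimes> sc r = sc r \<otimes> x"
    and T_quadratic: "1 \<le> i \<Longrightarrow> i < n \<Longrightarrow> T i \<otimes> T i = sc (q - 1) \<otimes> T i \<oplus> sc q"
    and T_braid_0: "1 < n \<Longrightarrow> T 0 \<otimes> T 1 \<otimes> T 0 \<otimes> T 1 = T 1 \<otimes> T 0 \<otimes> T 1 \<otimes> T 0"
    and L_1: "L 1 = T 0"
    and L_Suc: "1 \<le> k \<Longrightarrow> k < n \<Longrightarrow> L (Suc k) = sc q' \<otimes> T k \<otimes> L k \<otimes> T k"
begin

definition scale :: "'r \<Rightarrow> 'a \<Rightarrow> 'a" (infixr "\<bullet>" 72) where
  "r \<bullet> x = sc r \<otimes> x"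

lemma sc_zero: "sc 0 = \<zero>"
  using sc_add[of 0 0] add.l_cancel_one[of "sc 0" "sc 0"] by simp

lemma sc_minus: "sc (- r) = \<ominus> sc r"
  using sc_add[of "- r" r] by (intro minus_equality[symmetric]) (simp_all add: sc_zero)

lemma scale_closed [simp]: "x \<in> carrier H \<Longrightarrow> r \<bullet> x \<in> carrier H"
  by (simp add: scale_def)

lemma scale_simps [simp]:
  assumes "x \<in> carrier H"
  shows "r \<bullet> r' \<bullet> x = (r * r') \<bullet> x" "1 \<bullet> x = x" "0 \<bullet> x = \<zero>"
  using assms by (simp_all add: scale_def sc_mult sc_one sc_zero m_assoc)

lemma scale_add_left: "x \<in> carrier H \<Longrightarrow> (r + r') \<bullet> x = r \<bullet> x \<oplus> r' \<bullet> x"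
  by (simp add: scale_def sc_add l_distr)

lemma scale_mult [simp]:
  assumes "x \<in> carrier H" "y \<in> carrier H"
  shows "(r \<bullet> x) \<otimes> y = r \<bullet> (x \<otimes> y)" "x \<otimes> (r \<bullet> y) = r \<bullet> (x \<otimes> y)"
    "r \<bullet> (x \<oplus> y) = r \<bullet> x \<oplus> r \<bullet> y"
  using assms sc_central[of x r]
  by (simp_all add: scale_def m_assoc r_distr) (simp add: m_assoc[symmetric])

lemma scale_zero [simp]: "r \<bullet> \<zero> = \<zero>"
  by (simp add: scale_def)

lemma scale_one: "r \<bullet> \<one> = sc r"
  by (simp add: scale_def)

lemmas T_carrier [simp] = T_closed

lemma T_square: "1 \<le> i \<Longrightarrow> i < n \<Longrightarrow> T i \<otimes> T i = (q - 1) \<bullet> T i \<oplus> q \<bullet> \<one>"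
  by (simp add: T_quadratic scale_def)

lemma T_square_mult:
  assumes "1 \<le> i" "i < n" "x \<in> carrier H"
  shows "T i \<otimes> (T i \<otimes> x) = (q - 1) \<bullet> (T i \<otimes> x) \<oplus> q \<bullet> x"
  using assms T_square[of i] by (simp add: m_assoc[symmetric] l_distr)

lemma L_closed [simp]: "1 \<le> k \<Longrightarrow> k \<le> n \<Longrightarrow> L k \<in> carrier H"
proof (induction k rule: dec_induct)
  case base
  then show ?case using n_pos by (simp add: L_1[simplified])
next
  case (step k)
  then show ?case by (simp add: L_Suc)
qed

lemma L_Suc_scale: "1 \<le> k \<Longrightarrow> k < n \<Longrightarrow> L (Suc k) = q' \<bullet> (T k \<otimes> (L k \<otimes> T k))"
  by (simp add: L_Suc scale_def m_assoc)

text \<open>Multiply \<open>L (Suc i) = q' \<bullet> (T i \<otimes> (L i \<otimes> T i))\<close> by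
  \<open>T i\<close> on the right and expand the square; \<open>q' * q = 1\<close> frees the term
  \<open>T i \<otimes> L i\<close>. The rule \<open>T_L_Suc\<close> arises in the same way from
  multiplication on the left.\<close>

lemma T_L:
  assumes "1 \<le> i" "i < n"
  shows "T i \<otimes> L i = L (Suc i) \<otimes> T i \<oplus> (1 - q) \<bullet> L (Suc i)"
proof -
  have "L (Suc i) \<otimes> T i = (q' * (q - 1)) \<bullet> (T i \<otimes> (L i \<otimes> T i)) \<oplus> (q' * q) \<bullet> (T i \<otimes> L i)"
    using assms by (simp add: L_Suc_scale m_assoc T_square r_distr)
  also have "q' * q = 1" using q_inverse by (simp add: mult.commute)
  also have "(q' * (q - 1)) \<bullet> (T i \<otimes> (L i \<otimes> T i)) = (q - 1) \<bullet> L (Suc i)"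
    using assms by (simp add: L_Suc_scale mult.commute)
  finally have "L (Suc i) \<otimes> T i \<oplus> (1 - q) \<bullet> L (Suc i) =
      T i \<otimes> L i \<oplus> ((q - 1) \<bullet> L (Suc i) \<oplus> (1 - q) \<bullet> L (Suc i))"
    using assms by (simp add: a_ac)
  also have "(q - 1) \<bullet> L (Suc i) \<oplus> (1 - q) \<bullet> L (Suc i) = ((q - 1) + (1 - q)) \<bullet> L (Suc i)"
    using assms by (subst scale_add_left) simp_all
  finally show ?thesis using assms by simp
qed

lemma T_L_Suc:
  assumes "1 \<le> i" "i < n"
  shows "T i \<otimes> L (Suc i) = L i \<otimes> T i \<oplus> (q - 1) \<bullet> L (Suc i)"
proof -
  have "T i \<otimes> L (Suc i) = (q' * (q - 1)) \<bullet> (T i \<otimes> (L i \<otimes> T i)) \<oplus> (q' * q) \<bullet> (L i \<otimes> T i)"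
    using assms by (simp add: L_Suc_scale T_square_mult)
  also have "q' * q = 1" using q_inverse by (simp add: mult.commute)
  also have "(q' * (q - 1)) \<bullet> (T i \<otimes> (L i \<otimes> T i)) = (q - 1) \<bullet> L (Suc i)"
    using assms by (simp add: L_Suc_scale mult.commute)
  finally show ?thesis using assms by (simp add: a_comm)
qed

lemma commute_mult:
  assumes "x \<in> carrier H" "y \<in> carrier H" "z \<in> carrier H"
    and "x \<otimes> y = y \<otimes> x" "x \<otimes> z = z \<otimes> x"
  shows "x \<otimes> (y \<otimes> z) = (y \<otimes> z) \<otimes> x"
  using assms by (metis m_assoc)

lemma commute_foldr:
  assumes "x \<in> carrier H" "\<And>y. y \<in> set ys \<Longrightarrow> y \<in> carrier H \<and> x \<otimes> y = y \<otimes> x"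
  shows "foldr (\<otimes>) ys \<one> \<in> carrier H \<and> x \<otimes> foldr (\<otimes>) ys \<one> = foldr (\<otimes>) ys \<one> \<otimes> x"
  using assms by (induction ys) (simp_all add: commute_mult)

lemma commute_pow:
  assumes "x \<in> carrier H" "y \<in> carrier H" "x \<otimes> y = y \<otimes> x"
  shows "x \<otimes> y [^] (k::nat) = y [^] k \<otimes> x"
  using assms by (induction k) (simp_all add: commute_mult)

lemma T_commute': "i \<noteq> j \<Longrightarrow> Suc i \<noteq> j \<Longrightarrow> i \<noteq> Suc j \<Longrightarrow> i < n \<Longrightarrow> j < n \<Longrightarrow> T i \<otimes> T j = T j \<otimes> T i"
  using T_commute[of i j] T_commute[of j i] by (cases "i < j") auto

text \<open>
  Only \<open>i + 1 = j\<close> in the step to \<open>L (Suc j)\<close> is not formal; there the braid relation moves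
  \<open>T i\<close> through \<open>T j T i L i T i T j\<close>.
\<close>

lemma T_L_commute:
  assumes "i < n" "1 \<le> j" "j \<le> n" "i \<noteq> j" "Suc i \<noteq> j"
  shows "T i \<otimes> L j = L j \<otimes> T i"
  using assms
proof (induction j arbitrary: i rule: less_induct)
  case (less k)
  show ?case
  proof (cases "k = 1")
    case True
    then show ?thesis
      using less.prems n_pos T_commute'[of i 0] by (simp add: L_1[simplified])
  next
    case False
    then obtain j where j: "k = Suc j" "1 \<le> j" "j < n"
      using less.prems by (cases k) auto
    show ?thesis
    proof (cases "Suc i = j")
      case False
      have "T i \<otimes> T j = T j \<otimes> T i" "T i \<otimes> L j = L j \<otimes> T i"
        using less.prems less.IH[of j i] False j T_commute'[of i j] by auto
      then have "T i \<otimes> (T j \<otimes> (L j \<otimes> T j)) = (T j \<otimes> (L j \<otimes> T j)) \<otimes> T i"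
        using j less.prems by (intro commute_mult) simp_all
      then show ?thesis
        using j less.prems by (simp add: L_Suc_scale)
    next
      case True
      show ?thesis
      proof (cases "i = 0")
        case True
        \<comment> \<open>Here \<open>L 1 = T 0\<close>, and the braid relation of length four says
          that it commutes with \<open>T 1 \<otimes> (L 1 \<otimes> T 1)\<close>, of which
          \<open>L 2\<close> is a multiple.\<close>
        then have "j = 1" "1 < n" using \<open>Suc i = j\<close> j by auto
        then have "T 0 \<otimes> (T 1 \<otimes> (L 1 \<otimes> T 1)) = (T 1 \<otimes> (L 1 \<otimes> T 1)) \<otimes> T 0"
          using T_braid_0 unfolding L_1 by (simp add: m_assoc)
        then show ?thesis
          using j \<open>i = 0\<close> \<open>j = 1\<close> \<open>1 < n\<close> n_pos L_Suc_scale[of 1] by (simp del: One_nat_def)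
      next
        case False
        have i: "1 \<le> i" "i < n" using False less.prems by auto
        have br: "T i \<otimes> (T j \<otimes> T i) = T j \<otimes> (T i \<otimes> T j)"
          using T_braid[of i] i j True by (simp add: m_assoc)
        have cm: "T j \<otimes> L i = L i \<otimes> T j"
          using less.IH[of i j] i j True by simp
        have car: "T i \<in> carrier H" "T j \<in> carrier H" "L i \<in> carrier H"
          using i j by simp_all
        let ?y = "T j \<otimes> (T i \<otimes> (L i \<otimes> (T i \<otimes> T j)))"
        have "T i \<otimes> ?y = (T i \<otimes> (T j \<otimes> T i)) \<otimes> (L i \<otimes> (T i \<otimes> T j))"
          using car by (simp add: m_assoc)
        also have "\<dots> = T j \<otimes> (T i \<otimes> ((T j \<otimes> L i) \<otimes> (T i \<otimes> T j)))"
          using car unfolding br by (simp add: m_assoc)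
        also have "\<dots> = T j \<otimes> (T i \<otimes> (L i \<otimes> (T j \<otimes> (T i \<otimes> T j))))"
          using car unfolding cm by (simp add: m_assoc)
        also have "\<dots> = ?y \<otimes> T i"
          using car unfolding br[symmetric] by (simp add: m_assoc)
        finally have y: "T i \<otimes> ?y = ?y \<otimes> T i" .
        have "L k = (q' * q') \<bullet> ?y"
          using i j True car L_Suc_scale[of i] by (simp add: L_Suc_scale m_assoc)
        then show ?thesis
          using y car by simp
      qed
    qed
  qed
qed

text \<open>\<open>L i\<close> is built from \<open>T 0\<close>, ..., \<open>T (i - 1)\<close>, and
  for \<open>i < j\<close> each of these commutes with \<open>L j\<close> by
  \<open>T_L_commute\<close>.\<close>

lemma L_commute_less:
  assumes "1 \<le> i" "i < j" "j \<le> n"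
  shows "L j \<otimes> L i = L i \<otimes> L j"
  using assms
proof (induction i rule: dec_induct)
  case base
  then show ?case using T_L_commute[of 0 j] n_pos by (simp add: L_1[simplified])
next
  case (step i)
  have "L j \<otimes> (T i \<otimes> (L i \<otimes> T i)) = (T i \<otimes> (L i \<otimes> T i)) \<otimes> L j"
    using step T_L_commute[of i j] by (intro commute_mult) simp_all
  then show ?case
    using step by (simp add: L_Suc_scale)
qed

lemma L_commute:
  assumes "i \<in> {1..n}" "j \<in> {1..n}"
  shows "L i \<otimes> L j = L j \<otimes> L i"
  using L_commute_less[of i j] L_commute_less[of j i] assms by (cases i j rule: linorder_cases) auto

text \<open>The corrections in \<open>T_L\<close> and \<open>T_L_Suc\<close> produce opposite
  multiples of the square of \<open>L (Suc i)\<close>, which cancel. Common factors of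
  \<open>L i\<close> and \<open>L (Suc i)\<close> can thus be split off a monomial before
  straightening, and this keeps the maximal exponent from growing.\<close>

lemma T_L_L_Suc_commute:
  assumes "1 \<le> i" "i < n"
  shows "T i \<otimes> (L i \<otimes> L (Suc i)) = (L i \<otimes> L (Suc i)) \<otimes> T i"
proof -
  have car: "T i \<in> carrier H" "L i \<in> carrier H" "L (Suc i) \<in> carrier H"
    using assms by simp_all
  have "T i \<otimes> (L i \<otimes> L (Suc i)) = (L (Suc i) \<otimes> T i \<oplus> (1 - q) \<bullet> L (Suc i)) \<otimes> L (Suc i)"
    using car by (simp add: m_assoc[symmetric] T_L[OF assms])
  also have "\<dots> = L (Suc i) \<otimes> (L i \<otimes> T i \<oplus> (q - 1) \<bullet> L (Suc i)) \<oplus> (1 - q) \<bullet> (L (Suc i) \<otimes> L (Suc i))"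
    using car by (simp add: l_distr m_assoc T_L_Suc[OF assms])
  also have "\<dots> = L (Suc i) \<otimes> (L i \<otimes> T i) \<oplus> ((q - 1) + (1 - q)) \<bullet> (L (Suc i) \<otimes> L (Suc i))"
    using car by (subst scale_add_left) (simp_all add: r_distr a_assoc)
  also have "\<dots> = (L i \<otimes> L (Suc i)) \<otimes> T i"
    using car L_commute[of "Suc i" i] assms by (simp add: m_assoc[symmetric])
  finally show ?thesis .
qed

section \<open>Monomials in the Jucys--Murphy elements\<close>

definition L_mono :: "(nat \<Rightarrow> nat) \<Rightarrow> 'a" where
  "L_mono c = foldr (\<otimes>) (map (\<lambda>i. L i [^] c i) [1..<Suc n]) \<one>"

lemma foldr_closed: "set ys \<subseteq> carrier H \<Longrightarrow> foldr (\<otimes>) ys \<one> \<in> carrier H"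
  by (induction ys) auto

lemma L_mono_closed [simp]: "L_mono c \<in> carrier H"
  unfolding L_mono_def by (rule foldr_closed) auto

lemma L_mono_zero:
  assumes "\<And>i. i \<in> {1..n} \<Longrightarrow> c i = 0"
  shows "L_mono c = \<one>"
proof -
  have "set (map (\<lambda>i. L i [^] c i) [1..<Suc n]) \<subseteq> {\<one>}"
    using assms by auto
  moreover have "set ys \<subseteq> {\<one>} \<Longrightarrow> foldr (\<otimes>) ys \<one> = \<one>" for ys
    by (induction ys) auto
  ultimately show ?thesis unfolding L_mono_def by blast
qed

lemma L_mult_foldr:
  assumes k: "k \<in> {1..n}"
  shows "distinct is \<Longrightarrow> set is \<subseteq> {1..n} \<Longrightarrow> k \<in> set is \<Longrightarrow>
    L k \<otimes> foldr (\<otimes>) (map (\<lambda>i. L i [^] c i) is) \<one> =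
      foldr (\<otimes>) (map (\<lambda>i. L i [^] (c(k := Suc (c k))) i) is) \<one>"
proof (induction "is")
  case (Cons i "is")
  have car: "L i \<in> carrier H" "L k \<in> carrier H" using Cons k by auto
  have cl: "foldr (\<otimes>) (map (\<lambda>i. L i [^] c i) is) \<one> \<in> carrier H"
    by (rule foldr_closed) (use Cons in auto)
  show ?case
  proof (cases "i = k")
    case True
    then have tail: "map (\<lambda>i. L i [^] (c(k := Suc (c k))) i) is = map (\<lambda>i. L i [^] c i) is"
      using Cons by (intro map_cong) auto
    have "L k \<otimes> (L k [^] c k \<otimes> foldr (\<otimes>) (map (\<lambda>i. L i [^] c i) is) \<one>) =
      L k [^] Suc (c k) \<otimes> foldr (\<otimes>) (map (\<lambda>i. L i [^] c i) is) \<one>"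
      using car cl by (simp add: m_assoc[symmetric] commute_pow)
    then show ?thesis
      using True unfolding list.map foldr.simps o_apply tail by simp
  next
    case False
    have comm: "L k \<otimes> L i [^] c i = L i [^] c i \<otimes> L k"
      using car k Cons L_commute[of k i] by (intro commute_pow) auto
    have "L k \<otimes> (L i [^] c i \<otimes> foldr (\<otimes>) (map (\<lambda>i. L i [^] c i) is) \<one>) =
      L i [^] c i \<otimes> (L k \<otimes> foldr (\<otimes>) (map (\<lambda>i. L i [^] c i) is) \<one>)"
      using car cl comm by (simp add: m_assoc[symmetric])
    then show ?thesis
      using False Cons by simp
  qed
qed simp

lemma L_mult_mono:
  assumes "k \<in> {1..n}"
  shows "L k \<otimes> L_mono c = L_mono (c(k := Suc (c k)))"
  unfolding L_mono_def by (rule L_mult_foldr) (use assms in auto)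

lemma T_mono_commute:
  assumes "1 \<le> i" "i < n" "c i = 0" "c (Suc i) = 0"
  shows "T i \<otimes> L_mono c = L_mono c \<otimes> T i"
proof -
  have "y \<in> carrier H \<and> T i \<otimes> y = y \<otimes> T i"
    if "y \<in> set (map (\<lambda>j. L j [^] c j) [1..<Suc n])" for y
  proof -
    obtain j where j: "1 \<le> j" "j \<le> n" "y = L j [^] c j"
      using \<open>y \<in> _\<close> by auto
    have "T i \<otimes> L j [^] c j = L j [^] c j \<otimes> T i"
    proof (cases "j = i \<or> j = Suc i")
      case True
      then show ?thesis using assms by auto
    next
      case False
      then show ?thesis
        using T_L_commute[of i j] assms j by (intro commute_pow) auto
    qed
    then show ?thesis using j by simp
  qed
  then show ?thesis
    using commute_foldr[of "T i" "map (\<lambda>j. L j [^] c j) [1..<Suc n]"] assms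
    by (simp add: L_mono_def del: upt_Suc)
qed

section \<open>Linear spans\<close>

inductive_set lspan :: "'a set \<Rightarrow> 'a set" for S :: "'a set" where
  zero: "\<zero> \<in> lspan S"
| step: "x \<in> S \<Longrightarrow> y \<in> lspan S \<Longrightarrow> r \<bullet> x \<oplus> y \<in> lspan S"

lemma lspan_carrier:
  assumes "S \<subseteq> carrier H" "y \<in> lspan S"
  shows "y \<in> carrier H"
  using assms(2) by induction (use assms(1) in auto)

lemma lspan_base:
  assumes "S \<subseteq> carrier H" "x \<in> S"
  shows "x \<in> lspan S"
proof -
  have "1 \<bullet> x \<oplus> \<zero> \<in> lspan S" using assms by (intro lspan.intros)
  then show ?thesis using assms by (simp add: subset_iff)
qed

lemma lspan_add:
  assumes S: "S \<subseteq> carrier H" and "x \<in> lspan S" "y \<in> lspan S"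
  shows "x \<oplus> y \<in> lspan S"
  using assms(2)
proof induction
  case zero
  then show ?case using assms lspan_carrier[OF S] by simp
next
  case (step x z r)
  then have "r \<bullet> x \<oplus> (z \<oplus> y) \<in> lspan S" by (intro lspan.step)
  then show ?case
    using step S lspan_carrier[OF S] assms(3) by (simp add: a_assoc subset_iff)
qed

text \<open>This is the single induction behind the closure properties below, which apply it to
  multiplication by a scalar or by an element and to the identity map. Closure under scalars is
  proved inside because \<open>lspan_scale\<close> is itself such an instance.\<close>

lemma lspan_image:
  assumes S: "S \<subseteq> carrier H" and S': "S' \<subseteq> carrier H"
    and x: "x \<in> lspan S"
    and f0: "f \<zero> = \<zero>"
    and f: "\<And>r x y. x \<in> carrier H \<Longrightarrow> y \<in> carrier H \<Longrightarrow> f (r \<bullet> x \<oplus> y) = r \<bullet> f x \<oplus> f y"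
    and base: "\<And>x. x \<in> S \<Longrightarrow> f x \<in> lspan S'"
  shows "f x \<in> lspan S'"
proof -
  have scale: "r \<bullet> y \<in> lspan S'" if "y \<in> lspan S'" for r y
    using that
  proof induction
    case zero
    then show ?case by (simp add: lspan.zero)
  next
    case (step x y r')
    then have "(r * r') \<bullet> x \<oplus> r \<bullet> y \<in> lspan S'" by (intro lspan.step)
    then show ?case using step S' lspan_carrier[OF S'] by (simp add: subset_iff)
  qed
  from x show ?thesis
  proof induction
    case zero
    then show ?case by (simp add: f0 lspan.zero)
  next
    case (step x y r)
    then show ?case
      using f[of x y r] S lspan_carrier[OF S] lspan_add[OF S' scale[OF base]] by auto
  qed
qed

lemma lspan_scale:
  assumes S: "S \<subseteq> carrier H" and "x \<in> lspan S"
  shows "r \<bullet> x \<in> lspan S"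
proof (rule lspan_image[OF S S assms(2)])
  show "r \<bullet> x \<in> lspan S" if "x \<in> S" for x
    using lspan.step[OF that lspan.zero, of r] that S by auto
qed (simp_all add: mult.commute)

lemma lspan_l_mult:
  assumes S: "S \<subseteq> carrier H" and S': "S' \<subseteq> carrier H" and a: "a \<in> carrier H"
    and x: "x \<in> lspan S" and base: "\<And>x. x \<in> S \<Longrightarrow> a \<otimes> x \<in> lspan S'"
  shows "a \<otimes> x \<in> lspan S'"
  by (rule lspan_image[OF S S' x]) (use a base in \<open>simp_all add: r_distr\<close>)

lemma lspan_r_mult:
  assumes S: "S \<subseteq> carrier H" and S': "S' \<subseteq> carrier H" and a: "a \<in> carrier H"
    and x: "x \<in> lspan S" and base: "\<And>x. x \<in> S \<Longrightarrow> x \<otimes> a \<in> lspan S'"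
  shows "x \<otimes> a \<in> lspan S'"
  by (rule lspan_image[OF S S' x, of "\<lambda>x. x \<otimes> a"]) (use a base in \<open>simp_all add: l_distr\<close>)

lemma lspan_subset:
  assumes S: "S \<subseteq> carrier H" and S': "S' \<subseteq> carrier H"
    and x: "x \<in> lspan S" and base: "S \<subseteq> lspan S'"
  shows "x \<in> lspan S'"
  by (rule lspan_image[OF S S' x, of "\<lambda>x. x"]) (use base in auto)

section \<open>Straightening\<close>

text \<open>
  The exponents that arise when \<open>T i\<close> moves past a monomial. The total degree is kept, so no
  constant term appears, and the bound keeps them within the range of the Ariki--Koike basis.
\<close>

definition straightened :: "nat \<Rightarrow> (nat \<Rightarrow> nat) \<Rightarrow> (nat \<Rightarrow> nat) set" where
  "straightened i c = {c'. (\<forall>k. k \<noteq> i \<longrightarrow> k \<noteq> Suc i \<longrightarrow> c' k = c k) \<and>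
    c' i + c' (Suc i) = c i + c (Suc i) \<and>
    c' i \<le> max (c i) (c (Suc i)) \<and> c' (Suc i) \<le> max (c i) (c (Suc i))}"

text \<open>Induction on the degree in \<open>L i\<close> and \<open>L (Suc i)\<close>. If both
  occur, their product commutes with \<open>T i\<close> and is split off, which shifts both
  exponents and their bound by one. If only one occurs, one factor of it is moved through
  \<open>T i\<close>, and the correction is a monomial without \<open>T i\<close>.\<close>

lemma T_mono_straighten:
  assumes i: "1 \<le> i" "i < n"
  shows "T i \<otimes> L_mono c \<in>
    lspan {L_mono c' \<otimes> y | c' y. c' \<in> straightened i c \<and> y \<in> {\<one>, T i}}"
    (is "_ \<in> lspan (?E c)")
proof (induction "c i + c (Suc i)" arbitrary: c rule: less_induct)
  case less
  have E: "?E c \<subseteq> carrier H" for c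
    using i by auto
  have car: "L i \<in> carrier H" "L (Suc i) \<in> carrier H" "T i \<in> carrier H"
    using i by simp_all
  have idx: "i \<in> {1..n}" "Suc i \<in> {1..n}" using i by auto
  have self: "c \<in> straightened i c" for c
    by (simp add: straightened_def)
  consider "c i = 0 \<and> c (Suc i) = 0" | a b where "c i = Suc a" "c (Suc i) = Suc b"
    | b where "c i = 0" "c (Suc i) = Suc b" | a where "c i = Suc a" "c (Suc i) = 0"
    by (cases "c i"; cases "c (Suc i)") auto
  then show ?case
  proof cases
    case 1
    then have "T i \<otimes> L_mono c = L_mono c \<otimes> T i"
      using T_mono_commute[OF i] by simp
    then show ?thesis using self by (intro lspan_base[OF E]) auto
  next
    case 2
    define c0 where "c0 = c(i := a, Suc i := b)"
    have c: "L_mono c = (L i \<otimes> L (Suc i)) \<otimes> L_mono c0"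
      using 2 car idx by (simp add: m_assoc L_mult_mono c0_def) (metis fun_upd_triv fun_upd_twist n_not_Suc_n)
    have "(L i \<otimes> L (Suc i)) \<otimes> (T i \<otimes> L_mono c0) \<in> lspan (?E c)"
    proof (rule lspan_l_mult[OF E E])
      show "T i \<otimes> L_mono c0 \<in> lspan (?E c0)"
        by (rule less) (use 2 in \<open>simp add: c0_def\<close>)
    next
      fix x assume "x \<in> ?E c0"
      then obtain c' y where x: "x = L_mono c' \<otimes> y" "c' \<in> straightened i c0" "y \<in> {\<one>, T i}"
        by blast
      let ?c = "c'(i := Suc (c' i), Suc i := Suc (c' (Suc i)))"
      have "(L i \<otimes> L (Suc i)) \<otimes> x = L_mono ?c \<otimes> y"
        using x car idx
        by (auto simp: m_assoc[symmetric]) (simp_all add: m_assoc L_mult_mono fun_upd_twist)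
      moreover have "?c \<in> straightened i c"
        using x(2) 2 by (auto simp: straightened_def c0_def)
      ultimately show "(L i \<otimes> L (Suc i)) \<otimes> x \<in> lspan (?E c)"
        using x(3) by (intro lspan_base[OF E]) blast
    qed (use car in simp)
    also have "(L i \<otimes> L (Suc i)) \<otimes> (T i \<otimes> L_mono c0) = T i \<otimes> L_mono c"
      using car by (simp add: c m_assoc[symmetric]) (simp add: m_assoc T_L_L_Suc_commute[OF i, symmetric])
    finally show ?thesis .
  next
    case 3
    \<comment> \<open>Since \<open>c i = 0\<close>, removing one factor \<open>L (Suc i)\<close>
      lowers the maximum of the two exponents by one. This leaves room for the factor
      \<open>L i\<close> that appears on the left of \<open>T i\<close>.\<close>
    define c0 where "c0 = c(Suc i := b)"
    have c: "L_mono c = L (Suc i) \<otimes> L_mono c0"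
      using 3 car idx by (simp add: m_assoc L_mult_mono c0_def) (metis fun_upd_triv)
    have "L i \<otimes> (T i \<otimes> L_mono c0) \<in> lspan (?E c)"
    proof (rule lspan_l_mult[OF E E])
      show "T i \<otimes> L_mono c0 \<in> lspan (?E c0)"
        by (rule less) (use 3 in \<open>simp add: c0_def\<close>)
    next
      fix x assume "x \<in> ?E c0"
      then obtain c' y where x: "x = L_mono c' \<otimes> y" "c' \<in> straightened i c0" "y \<in> {\<one>, T i}"
        by blast
      let ?c = "c'(i := Suc (c' i))"
      have "L i \<otimes> x = L_mono ?c \<otimes> y"
        using x car idx by (auto simp: m_assoc[symmetric] L_mult_mono)
      moreover have "?c \<in> straightened i c"
        using x(2) 3 by (auto simp: straightened_def c0_def)
      ultimately show "L i \<otimes> x \<in> lspan (?E c)"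
        using x(3) by (intro lspan_base[OF E]) blast
    qed (use car in simp)
    moreover have "L_mono c \<otimes> \<one> \<in> lspan (?E c)"
      by (intro lspan_base[OF E]) (blast intro: self)
    ultimately have "L i \<otimes> (T i \<otimes> L_mono c0) \<oplus> (q - 1) \<bullet> L_mono c \<in> lspan (?E c)"
      by (intro lspan_add[OF E] lspan_scale[OF E]) simp_all
    also have "L i \<otimes> (T i \<otimes> L_mono c0) \<oplus> (q - 1) \<bullet> L_mono c = T i \<otimes> L_mono c"
      using car by (simp add: c m_assoc[symmetric] T_L_Suc[OF i] l_distr)
    finally show ?thesis .
  next
    case 4
    define c0 where "c0 = c(i := a)"
    have c: "L_mono c = L i \<otimes> L_mono c0"
      using 4 car idx by (simp add: m_assoc L_mult_mono c0_def) (metis fun_upd_triv)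
    \<comment> \<open>Used twice: for the main term, and for the correction, whose monomial differs
      from \<open>L_mono c\<close> here, because one factor \<open>L i\<close> has turned into
      \<open>L (Suc i)\<close>.\<close>
    have E': "L (Suc i) \<otimes> x \<in> lspan (?E c)" if "x \<in> ?E c0" for x
    proof -
      obtain c' y where x: "x = L_mono c' \<otimes> y" "c' \<in> straightened i c0" "y \<in> {\<one>, T i}"
        using \<open>x \<in> ?E c0\<close> by blast
      let ?c = "c'(Suc i := Suc (c' (Suc i)))"
      have "L (Suc i) \<otimes> x = L_mono ?c \<otimes> y"
        using x car idx by (auto simp: m_assoc[symmetric] L_mult_mono)
      moreover have "?c \<in> straightened i c"
        using x(2) 4 by (auto simp: straightened_def c0_def)
      ultimately show "L (Suc i) \<otimes> x \<in> lspan (?E c)"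
        using x(3) by (intro lspan_base[OF E]) blast
    qed
    have "L (Suc i) \<otimes> (T i \<otimes> L_mono c0) \<in> lspan (?E c)"
    proof (rule lspan_l_mult[OF E E])
      show "T i \<otimes> L_mono c0 \<in> lspan (?E c0)"
        by (rule less) (use 4 in \<open>simp add: c0_def\<close>)
    qed (use car E' in auto)
    moreover have "L_mono c0 \<otimes> \<one> \<in> ?E c0"
      using self by blast
    then have "L (Suc i) \<otimes> L_mono c0 \<in> lspan (?E c)"
      using E' by force
    ultimately have "L (Suc i) \<otimes> (T i \<otimes> L_mono c0) \<oplus> (1 - q) \<bullet> (L (Suc i) \<otimes> L_mono c0) \<in> lspan (?E c)"
      by (intro lspan_add[OF E] lspan_scale[OF E]) simp_all
    also have "L (Suc i) \<otimes> (T i \<otimes> L_mono c0) \<oplus> (1 - q) \<bullet> (L (Suc i) \<otimes> L_mono c0) = T i \<otimes> L_mono c"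
      using car by (simp add: c m_assoc[symmetric] T_L[OF i] l_distr)
    finally show ?thesis .
  qed
qed

section \<open>Multiplication by generators on the span of basis elements\<close>

definition T_basis :: "'a set" where
  "T_basis = {T_of_perm w | w. w permutes {1..n}}"

text \<open>For \<open>m = ell - 1\<close> these are the Ariki--Koike basis elements with a
  nonconstant monomial; the form vanishes on all of them.\<close>

definition positive_basis :: "nat \<Rightarrow> 'a set" where
  "positive_basis m = {L_mono c \<otimes> T_of_perm w | c w.
    w permutes {1..n} \<and> (\<forall>i\<in>{1..n}. c i \<le> m) \<and> (\<exists>i\<in>{1..n}. c i \<noteq> 0)}"

lemma T_basis_carrier: "T_basis \<subseteq> carrier H"
  by (auto simp: T_basis_def T_of_perm_closed)

lemma positive_basis_carrier: "positive_basis m \<subseteq> carrier H"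
  by (auto simp: positive_basis_def T_of_perm_closed)

lemma T_of_perm_lspan: "w permutes {1..n} \<Longrightarrow> T_of_perm w \<in> lspan T_basis"
  by (rule lspan_base[OF T_basis_carrier]) (unfold T_basis_def, blast)

lemma positive_basisI:
  assumes "w permutes {1..n}" "\<And>i. i \<in> {1..n} \<Longrightarrow> c i \<le> m" "\<exists>i\<in>{1..n}. c i \<noteq> 0"
  shows "L_mono c \<otimes> T_of_perm w \<in> positive_basis m"
  unfolding positive_basis_def using assms by blast

lemma positive_basisE:
  assumes "x \<in> positive_basis m"
  obtains c w where "x = L_mono c \<otimes> T_of_perm w" "w permutes {1..n}"
    "\<forall>i\<in>{1..n}. c i \<le> m" "\<exists>i\<in>{1..n}. c i \<noteq> 0"
  using assms unfolding positive_basis_def by blast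

lemma T_mult_descent:
  assumes w: "w permutes {1..n}" and i: "1 \<le> i" "i < n" and "w (Suc i) < w i"
  shows "T i \<otimes> T_of_perm w =
    (q - 1) \<bullet> T_of_perm w \<oplus> q \<bullet> T_of_perm (w \<circ> transpose i (Suc i))"
proof -
  let ?v = "w \<circ> transpose i (Suc i)"
  have v: "?v permutes {1..n}"
    by (rule permutes_compose[OF transpose_permutes[OF i] w])
  have "T i \<otimes> T_of_perm ?v = T_of_perm (?v \<circ> transpose i (Suc i))"
    by (rule T_mult_ascent[OF v i]) (use assms in simp)
  also have "?v \<circ> transpose i (Suc i) = w"
    by (simp add: comp_assoc)
  finally have *: "T_of_perm w = T i \<otimes> T_of_perm ?v" by (rule sym)
  then show ?thesis
    using T_square_mult[OF i T_of_perm_closed[OF v]] by (simp only:)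
qed

lemma T_mult_T_of_perm:
  assumes w: "w permutes {1..n}" and i: "1 \<le> i" "i < n"
  shows "T i \<otimes> T_of_perm w \<in> lspan T_basis"
proof -
  let ?v = "w \<circ> transpose i (Suc i)"
  have v: "?v permutes {1..n}"
    by (rule permutes_compose[OF transpose_permutes[OF i] w])
  have b: "T_of_perm w \<in> lspan T_basis" "T_of_perm ?v \<in> lspan T_basis"
    using w v by (simp_all only: T_of_perm_lspan)
  show ?thesis
    using permutes_ascent_or_descent[OF w, of i] T_mult_ascent[OF w i] T_mult_descent[OF w i] b
      lspan_add[OF T_basis_carrier] lspan_scale[OF T_basis_carrier]
    by metis
qed

lemma T_word_mult_lspan:
  assumes "set is \<subseteq> {1..<n}" "x \<in> lspan T_basis"
  shows "T_word is \<otimes> x \<in> lspan T_basis"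
  using assms(1)
proof (induction "is")
  case Nil
  then show ?case using assms lspan_carrier[OF T_basis_carrier] by simp
next
  case (Cons i "is")
  have "T i \<otimes> (T_word is \<otimes> x) \<in> lspan T_basis"
  proof (rule lspan_l_mult[OF T_basis_carrier T_basis_carrier])
    show "T i \<otimes> y \<in> lspan T_basis" if "y \<in> T_basis" for y
      using that T_mult_T_of_perm Cons by (auto simp: T_basis_def)
  qed (use Cons in auto)
  moreover have "set is \<subseteq> {..<n}" using Cons by auto
  ultimately show ?case
    using Cons T_word_closed lspan_carrier[OF T_basis_carrier assms(2)] by (simp add: m_assoc)
qed

lemma mono_mult_lspan:
  assumes c: "\<And>i. i \<in> {1..n} \<Longrightarrow> c i \<le> m" "\<exists>i\<in>{1..n}. c i \<noteq> 0" and x: "x \<in> lspan T_basis"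
  shows "L_mono c \<otimes> x \<in> lspan (positive_basis m)"
proof (rule lspan_l_mult[OF T_basis_carrier positive_basis_carrier _ x])
  fix y assume "y \<in> T_basis"
  then have "L_mono c \<otimes> y \<in> positive_basis m"
    unfolding T_basis_def using positive_basisI[OF _ c] by blast
  then show "L_mono c \<otimes> y \<in> lspan (positive_basis m)"
    by (rule lspan_base[OF positive_basis_carrier])
qed simp

text \<open>Monomials stand on the left, so only a product of two elements \<open>T_of_perm\<close>
  has to be rewritten, and it stays in the span of \<open>T_basis\<close>.\<close>

lemma positive_mult_T_of_perm:
  assumes x: "x \<in> lspan (positive_basis m)" and v: "v permutes {1..n}"
  shows "x \<otimes> T_of_perm v \<in> lspan (positive_basis m)"
proof (rule lspan_r_mult[OF positive_basis_carrier positive_basis_carrier _ x])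
  fix y assume "y \<in> positive_basis m"
  then obtain c w where y: "y = L_mono c \<otimes> T_of_perm w" "w permutes {1..n}"
    "\<forall>i\<in>{1..n}. c i \<le> m" "\<exists>i\<in>{1..n}. c i \<noteq> 0"
    by (rule positive_basisE)
  obtain "is" where is': "reduced_word n is" "perm_of_word is = w"
    using ex_reduced_word[OF y(2)] by blast
  have "T_of_perm v \<in> lspan T_basis"
    by (rule T_of_perm_lspan[OF v])
  then have "T_word is \<otimes> T_of_perm v \<in> lspan T_basis"
    using is'(1) by (intro T_word_mult_lspan) (simp_all add: reduced_word_def)
  then have "T_of_perm w \<otimes> T_of_perm v \<in> lspan T_basis"
    using T_of_perm_eq[OF is'(1)] by (simp only: is'(2))
  from mono_mult_lspan[OF bspec[OF y(3)] y(4) this]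
  show "y \<otimes> T_of_perm v \<in> lspan (positive_basis m)"
    using y(1,2) v by (simp add: m_assoc T_of_perm_closed)
qed (use v in \<open>simp add: T_of_perm_closed\<close>)

text \<open>Straightening respects both conditions on the exponents: the maximum stays at most
  \<open>m\<close>, and as the degree is kept the monomial remains nonconstant. A generator left
  over to its right is absorbed into the span of \<open>T_basis\<close>.\<close>

lemma T_mult_positive:
  assumes x: "x \<in> lspan (positive_basis m)" and i: "1 \<le> i" "i < n"
  shows "T i \<otimes> x \<in> lspan (positive_basis m)"
proof (rule lspan_l_mult[OF positive_basis_carrier positive_basis_carrier _ x])
  fix y assume "y \<in> positive_basis m"
  then obtain c w where y: "y = L_mono c \<otimes> T_of_perm w" "w permutes {1..n}"
    "\<forall>i\<in>{1..n}. c i \<le> m" "\<exists>i\<in>{1..n}. c i \<noteq> 0"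
    by (rule positive_basisE)
  let ?E = "{L_mono c' \<otimes> z | c' z. c' \<in> straightened i c \<and> z \<in> {\<one>, T i}}"
  have E: "?E \<subseteq> carrier H" using i by auto
  have "(T i \<otimes> L_mono c) \<otimes> T_of_perm w \<in> lspan (positive_basis m)"
  proof (rule lspan_r_mult[OF E positive_basis_carrier _ T_mono_straighten[OF i]])
    fix x assume "x \<in> ?E"
    then obtain c' z where x: "x = L_mono c' \<otimes> z" "c' \<in> straightened i c" "z \<in> {\<one>, T i}"
      by blast
    have idx: "i \<in> {1..n}" "Suc i \<in> {1..n}" using i by auto
    have le: "c' k \<le> m" if "k \<in> {1..n}" for k
      using x(2) bspec[OF y(3) that] bspec[OF y(3) idx(1)] bspec[OF y(3) idx(2)]
      by (cases "k = i \<or> k = Suc i") (auto simp: straightened_def)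
    have pos: "\<exists>k\<in>{1..n}. c' k \<noteq> 0"
    proof -
      obtain k where k: "k \<in> {1..n}" "c k \<noteq> 0" using y(4) by blast
      show ?thesis
      proof (cases "k = i \<or> k = Suc i")
        case True
        then have "c' i \<noteq> 0 \<or> c' (Suc i) \<noteq> 0"
          using x(2) k by (auto simp: straightened_def)
        then show ?thesis using idx by blast
      next
        case False
        then have "c' k = c k" using x(2) by (simp add: straightened_def)
        then show ?thesis using k by metis
      qed
    qed
    have "T_of_perm w \<in> lspan T_basis"
      by (rule T_of_perm_lspan[OF y(2)])
    then have "z \<otimes> T_of_perm w \<in> lspan T_basis"
      using x(3) T_mult_T_of_perm[OF y(2) i] y(2) by (auto simp: T_of_perm_closed)
    from mono_mult_lspan[OF le pos this]
    show "x \<otimes> T_of_perm w \<in> lspan (positive_basis m)"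
      using x(1,3) y(2) i by (auto simp: m_assoc T_of_perm_closed)
  qed (use y in \<open>simp add: T_of_perm_closed\<close>)
  then show "T i \<otimes> y \<in> lspan (positive_basis m)"
    using y(1,2) i by (simp add: m_assoc T_of_perm_closed)
qed (use i in simp)

lemma T_word_mult_positive:
  assumes x: "x \<in> lspan (positive_basis m)" and "set is \<subseteq> {1..<n}"
  shows "T_word is \<otimes> x \<in> lspan (positive_basis m)"
  using assms(2)
proof (induction "is")
  case Nil
  then show ?case using x lspan_carrier[OF positive_basis_carrier] by simp
next
  case (Cons i "is")
  then have "T i \<otimes> (T_word is \<otimes> x) \<in> lspan (positive_basis m)"
    by (intro T_mult_positive) auto
  moreover have "set is \<subseteq> {..<n}" using Cons by auto
  ultimately show ?case
    using Cons T_word_closed lspan_carrier[OF positive_basis_carrier x] by (simp add: m_assoc)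
qed

section \<open>The constant term of a product of linear factors\<close>

definition L_factors :: "(nat \<times> 'r) list \<Rightarrow> 'a" where
  "L_factors ps = foldr (\<otimes>) (map (\<lambda>(k, r). L k \<ominus> sc r) ps) \<one>"

definition bounded_monos :: "(nat \<Rightarrow> nat) \<Rightarrow> 'a set" where
  "bounded_monos b = {L_mono c | c. (\<forall>i\<in>{1..n}. c i \<le> b i) \<and> (\<exists>i\<in>{1..n}. c i \<noteq> 0)}"

lemma bounded_monos_carrier: "bounded_monos b \<subseteq> carrier H"
  by (auto simp: bounded_monos_def)

lemma bounded_monos_mono:
  assumes "\<And>i. i \<in> {1..n} \<Longrightarrow> b i \<le> b' i"
  shows "bounded_monos b \<subseteq> bounded_monos b'"
  unfolding bounded_monos_def using assms order_trans by blast

text \<open>Expand one factor at a time. Choosing \<open>L k\<close> raises the exponent at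
  \<open>k\<close> only, so the number of factors with index \<open>k\<close> bounds it; the
  constant term arises by choosing \<open>- r\<close> in every factor.\<close>

lemma L_factors_constant_term:
  assumes "fst ` set ps \<subseteq> {1..n}"
  shows "\<exists>y \<in> lspan (bounded_monos (\<lambda>k. length (filter (\<lambda>p. fst p = k) ps))).
    L_factors ps = (\<Prod>p\<leftarrow>ps. - snd p) \<bullet> \<one> \<oplus> y"
  using assms
proof (induction ps)
  case Nil
  then show ?case by (intro bexI[of _ \<zero>]) (simp_all add: L_factors_def lspan.zero)
next
  case (Cons p ps)
  obtain k r where p: "p = (k, r)" by (cases p)
  have k: "k \<in> {1..n}" using Cons p by auto
  then have Lk: "L k \<in> carrier H" by simp
  let ?b = "\<lambda>k. length (filter (\<lambda>p. fst p = k) ps)"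
  let ?B = "bounded_monos (\<lambda>k. length (filter (\<lambda>p. fst p = k) (p # ps)))"
  let ?c = "\<Prod>p\<leftarrow>ps. - snd p"
  note B = bounded_monos_carrier
  obtain y where y: "y \<in> lspan (bounded_monos ?b)" "L_factors ps = ?c \<bullet> \<one> \<oplus> y"
    using Cons by auto
  have y_car: "y \<in> carrier H" using lspan_carrier[OF B y(1)] .
  have "bounded_monos ?b \<subseteq> ?B"
    by (rule bounded_monos_mono) simp
  then have 1: "y \<in> lspan ?B"
    using lspan_base[OF B] by (intro lspan_subset[OF B B y(1)]) blast
  have 2: "L k \<otimes> y \<in> lspan ?B"
  proof (rule lspan_l_mult[OF B B Lk y(1)])
    fix x assume "x \<in> bounded_monos ?b"
    then obtain c where c: "x = L_mono c" "\<forall>i\<in>{1..n}. c i \<le> ?b i"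
      by (auto simp: bounded_monos_def)
    then have "L_mono (c(k := Suc (c k))) \<in> ?B"
      using k unfolding bounded_monos_def p by (intro CollectI exI conjI refl ballI bexI[of _ k]) auto
    then show "L k \<otimes> x \<in> lspan ?B"
      using c(1) L_mult_mono[OF k] lspan_base[OF B] by simp
  qed
  have "L_mono ((\<lambda>_. 0)(k := Suc 0)) = L k"
    using L_mult_mono[OF k, of "\<lambda>_. 0"] Lk by (simp add: L_mono_zero)
  moreover have "L_mono ((\<lambda>_. 0)(k := Suc 0)) \<in> ?B"
    using k unfolding bounded_monos_def p by (intro CollectI exI conjI refl ballI bexI[of _ k]) auto
  ultimately have 3: "L k \<in> lspan ?B"
    using lspan_base[OF B] by simp
  have "L_factors (p # ps) = (L k \<oplus> (- r) \<bullet> \<one>) \<otimes> (?c \<bullet> \<one> \<oplus> y)"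
    unfolding y(2)[symmetric] p by (simp add: L_factors_def scale_one sc_minus minus_eq)
  also have "\<dots> = (- r * ?c) \<bullet> \<one> \<oplus> (?c \<bullet> L k \<oplus> (L k \<otimes> y \<oplus> (- r) \<bullet> y))"
    using Lk y_car by (simp add: l_distr r_distr a_ac mult.commute)
  finally show ?case
    using 1 2 3 B p by (intro bexI[of _ "?c \<bullet> L k \<oplus> (L k \<otimes> y \<oplus> (- r) \<bullet> y)"])
      (auto intro!: lspan_add[OF B] lspan_scale[OF B])
qed

end

section \<open>The form on products\<close>

locale hecke_form = hecke_relations H n T q q' sc L
  for H (structure) and n and T :: "nat \<Rightarrow> 'a" and q q' :: "'r::comm_ring_1" and sc L +
  fixes m :: nat and \<tau> :: "'a \<Rightarrow> 'r"
  assumes \<tau>_add: "x \<in> carrier H \<Longrightarrow> y \<in> carrier H \<Longrightarrow> \<tau> (x \<oplus> y) = \<tau> x + \<tau> y"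
    and \<tau>_scale: "x \<in> carrier H \<Longrightarrow> \<tau> (sc r \<otimes> x) = r * \<tau> x"
    and \<tau>_basis: "w permutes {1..n} \<Longrightarrow> (\<And>i. i \<in> {1..n} \<Longrightarrow> c i \<le> m) \<Longrightarrow>
      \<tau> (L_mono c \<otimes> T_of_perm w) = (if w = id \<and> (\<forall>i\<in>{1..n}. c i = 0) then 1 else 0)"
begin

lemma \<tau>_scale' [simp]: "x \<in> carrier H \<Longrightarrow> \<tau> (r \<bullet> x) = r * \<tau> x"
  by (simp add: scale_def \<tau>_scale)

lemma \<tau>_zero [simp]: "\<tau> \<zero> = 0"
  using \<tau>_scale'[of \<one> 0] by simp

lemma \<tau>_positive:
  assumes "x \<in> lspan (positive_basis m)"
  shows "\<tau> x = 0"
  using assms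
proof induction
  case (step x y r)
  have "\<tau> x = 0"
    using step(1) \<tau>_basis by (elim positive_basisE) fastforce
  then show ?case
    using step(3) subsetD[OF positive_basis_carrier step(1)]
      lspan_carrier[OF positive_basis_carrier step(2)]
    by (simp add: \<tau>_add)
qed simp

lemma \<tau>_T_of_perm:
  assumes "w permutes {1..n}"
  shows "\<tau> (T_of_perm w) = (if w = id then 1 else 0)"
  using \<tau>_basis[OF assms, of "\<lambda>_. 0"] T_of_perm_closed[OF assms]
  by (simp add: L_mono_zero)

lemma T_word_snoc:
  assumes "set is \<subseteq> {..<n}" "i < n"
  shows "T_word (is @ [i]) = T_word is \<otimes> T i"
  using assms by (simp add: T_word_append)

text \<open>The letter \<open>i\<close> that meets \<open>T_of_perm w\<close> is an ascent of the
  tail \<open>?v\<close>. If it is an ascent of \<open>w\<close> too, then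
  \<open>w \<circ> ?s\<close> descends there and differs from \<open>?v\<close>, so the value is
  zero. If it is a descent of \<open>w\<close>, then \<open>w\<close> differs from
  \<open>?v\<close>, the term with \<open>q - 1\<close> vanishes, and the other one contributes a
  factor \<open>q\<close>.\<close>

lemma \<tau>_rev_word:
  assumes "reduced_word n is" "w permutes {1..n}"
  shows "\<tau> (T_word (rev is) \<otimes> T_of_perm w) = (if w = perm_of_word is then q ^ length is else 0)"
  using assms
proof (induction "is" arbitrary: w)
  case Nil
  then show ?case using \<tau>_T_of_perm by (simp only: rev.simps T_word_simps perm_of_word.simps list.size power_0 l_one T_of_perm_closed)
next
  case (Cons i "is")
  let ?s = "transpose i (Suc i)" and ?v = "perm_of_word is"
  have i: "1 \<le> i" "i < n" "reduced_word n is" and asc: "?v i < ?v (Suc i)"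
    using Cons.prems(1) by (simp_all add: reduced_word_Cons)
  note w = Cons.prems(2)
  have ws: "w \<circ> ?s permutes {1..n}"
    by (rule permutes_compose[OF transpose_permutes[OF i(1,2)] w])
  have car: "T_word (rev is) \<in> carrier H" "T_of_perm w \<in> carrier H" "T_of_perm (w \<circ> ?s) \<in> carrier H"
    using T_word_closed[of "rev is"] reduced_word_lessThan[OF i(3)] T_of_perm_closed w ws by auto
  have eq: "T_word (rev (i # is)) \<otimes> T_of_perm w = T_word (rev is) \<otimes> (T i \<otimes> T_of_perm w)"
    using T_word_snoc[of "rev is" i] reduced_word_lessThan[OF i(3)] i car by (simp add: m_assoc)
  have cancel: "w = ?v \<circ> ?s \<longleftrightarrow> w \<circ> ?s = ?v"
  proof
    show "w \<circ> ?s = ?v" if "w = ?v \<circ> ?s" unfolding that by (simp add: comp_assoc)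
    show "w = ?v \<circ> ?s" if "w \<circ> ?s = ?v" unfolding that[symmetric] by (simp add: comp_assoc)
  qed
  show ?case
  proof (cases "w i < w (Suc i)")
    case True
    have "w \<circ> ?s \<noteq> ?v"
    proof
      assume "w \<circ> ?s = ?v"
      from fun_cong[OF this, of i] fun_cong[OF this, of "Suc i"]
      have "w (Suc i) = ?v i" "w i = ?v (Suc i)" by simp_all
      then show False using asc True by simp
    qed
    then show ?thesis
      using Cons.IH[OF i(3) ws] cancel unfolding eq T_mult_ascent[OF w i(1,2) True]
      by (simp only: perm_of_word.simps if_False)
  next
    case False
    then have desc: "w (Suc i) < w i"
      using permutes_ascent_or_descent[OF w] by blast
    then have "w \<noteq> ?v" using asc by auto
    have "\<tau> (T_word (rev is) \<otimes> (T i \<otimes> T_of_perm w)) =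
      (q - 1) * \<tau> (T_word (rev is) \<otimes> T_of_perm w) + q * \<tau> (T_word (rev is) \<otimes> T_of_perm (w \<circ> ?s))"
      unfolding T_mult_descent[OF w i(1,2) desc] using car by (simp add: r_distr \<tau>_add)
    also have "\<dots> = (if w \<circ> ?s = ?v then q ^ Suc (length is) else 0)"
      unfolding Cons.IH[OF i(3) w] Cons.IH[OF i(3) ws] using \<open>w \<noteq> ?v\<close> by simp
    finally show ?thesis
      unfolding eq by (simp only: perm_of_word.simps cancel list.size add_Suc_right add_0_right)
  qed
qed

text \<open>The bound \<open>le\<close> places the nonconstant part of the product in the span of
  \<open>positive_basis m\<close>. That span is stable under \<open>T\<close> from both sides, and
  the form vanishes on it.\<close>

lemma \<tau>_constant_term:
  assumes ps: "fst ` set ps \<subseteq> {1..n}"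
    and le: "\<And>k. k \<in> {1..n} \<Longrightarrow> length (filter (\<lambda>p. fst p = k) ps) \<le> m"
    and "set is \<subseteq> {1..<n}" and w: "w permutes {1..n}" and d: "d permutes {1..n}"
  shows "\<tau> (T_word is \<otimes> (T_of_perm w \<otimes> L_factors ps) \<otimes> T_of_perm d) =
    (\<Prod>p\<leftarrow>ps. - snd p) * \<tau> (T_word is \<otimes> T_of_perm w \<otimes> T_of_perm d)"
proof -
  let ?b = "\<lambda>k. length (filter (\<lambda>p. fst p = k) ps)"
  let ?c = "\<Prod>p\<leftarrow>ps. - snd p"
  obtain y where y: "y \<in> lspan (bounded_monos ?b)" "L_factors ps = ?c \<bullet> \<one> \<oplus> y"
    using L_factors_constant_term[OF ps] by blast
  have "bounded_monos ?b \<subseteq> positive_basis m"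
  proof
    fix x assume "x \<in> bounded_monos ?b"
    then obtain c where c: "x = L_mono c" "\<forall>i\<in>{1..n}. c i \<le> ?b i" "\<exists>i\<in>{1..n}. c i \<noteq> 0"
      by (auto simp: bounded_monos_def)
    then have "x = L_mono c \<otimes> T_of_perm id" by simp
    moreover have "\<forall>i\<in>{1..n}. c i \<le> m" using c(2) le le_trans by blast
    ultimately show "x \<in> positive_basis m"
      using c(3) permutes_id unfolding positive_basis_def by blast
  qed
  then have "y \<in> lspan (positive_basis m)"
    using lspan_base[OF positive_basis_carrier]
    by (intro lspan_subset[OF bounded_monos_carrier positive_basis_carrier y(1)]) blast
  moreover obtain js where js: "reduced_word n js" "perm_of_word js = w"
    using ex_reduced_word[OF w] by blast
  then have "T_of_perm w = T_word js" "set js \<subseteq> {1..<n}"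
    using T_of_perm_eq[OF js(1)] by (simp_all only: js(2) reduced_word_def)
  ultimately have "T_word is \<otimes> (T_of_perm w \<otimes> y) \<otimes> T_of_perm d \<in> lspan (positive_basis m)"
    using assms by (simp add: T_word_mult_positive positive_mult_T_of_perm)
  then have zero: "\<tau> (T_word is \<otimes> (T_of_perm w \<otimes> y) \<otimes> T_of_perm d) = 0"
    by (rule \<tau>_positive)
  have "set is \<subseteq> {..<n}" using assms by auto
  then have car: "T_word is \<in> carrier H" "T_of_perm w \<in> carrier H" "T_of_perm d \<in> carrier H" "y \<in> carrier H"
    using T_word_closed T_of_perm_closed w d lspan_carrier[OF bounded_monos_carrier y(1)] by auto
  then have "T_word is \<otimes> (T_of_perm w \<otimes> L_factors ps) \<otimes> T_of_perm d =
    ?c \<bullet> (T_word is \<otimes> T_of_perm w \<otimes> T_of_perm d) \<oplus> T_word is \<otimes> (T_of_perm w \<otimes> y) \<otimes> T_of_perm d"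
    unfolding y(2) by (simp add: r_distr l_distr)
  then show ?thesis
    using car zero by (simp add: \<tau>_add)
qed

lemma \<tau>_finsum:
  assumes "finite W" "f \<in> W \<rightarrow> carrier H"
  shows "\<tau> (finsum H f W) = (\<Sum>w\<in>W. \<tau> (f w))"
  using assms by (induction W) (simp_all add: \<tau>_add Pi_iff finsum_insert)

text \<open>Condition \<open>add\<close> makes the lengths of \<open>w\<close> and \<open>d\<close>
  add up, so that after removal of the linear factors \<open>T_of_perm w\<close> and
  \<open>T_of_perm d\<close> merge into \<open>T_of_perm (d \<circ> w)\<close>. Then
  \<open>\<tau>_rev_word\<close> selects the \<open>w\<close> for which this is the permutation of
  \<open>is\<close>.\<close>

lemma \<tau>_murphy_product:
  assumes ps: "fst ` set ps \<subseteq> {1..n}"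
    and le: "\<And>k. k \<in> {1..n} \<Longrightarrow> length (filter (\<lambda>p. fst p = k) ps) \<le> m"
    and "is": "reduced_word n is" and d: "d permutes {1..n}"
    and W: "finite W" "\<And>w. w \<in> W \<Longrightarrow> w permutes {1..n}"
    and add: "\<And>w a b. w \<in> W \<Longrightarrow> a < b \<Longrightarrow> w b < w a \<Longrightarrow> d (w b) < d (w a)"
  shows "\<tau> (T_word (rev is) \<otimes> ((\<Oplus>w\<in>W. T_of_perm w) \<otimes> L_factors ps) \<otimes> T_of_perm d) =
    (\<Prod>p\<leftarrow>ps. - snd p) * (\<Sum>w\<in>W. if d \<circ> w = perm_of_word is then q ^ length is else 0)"
proof -
  have set_is: "set (rev is) \<subseteq> {1..<n}" "set (rev is) \<subseteq> {..<n}"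
    using "is" by (auto simp: reduced_word_def)
  have "L k \<ominus> sc r \<in> carrier H" if "(k, r) \<in> set ps" for k r
  proof -
    have "k \<in> {1..n}" using ps that by force
    then show ?thesis by simp
  qed
  then have F: "L_factors ps \<in> carrier H"
    unfolding L_factors_def by (intro foldr_closed) auto
  have car: "T_word (rev is) \<in> carrier H" "T_of_perm d \<in> carrier H"
    "\<And>w. w \<in> W \<Longrightarrow> T_of_perm w \<in> carrier H"
    using T_word_closed[OF set_is(2)] T_of_perm_closed d W(2) by auto
  have "T_word (rev is) \<otimes> ((\<Oplus>w\<in>W. T_of_perm w) \<otimes> L_factors ps) \<otimes> T_of_perm d =
    (\<Oplus>w\<in>W. T_word (rev is) \<otimes> (T_of_perm w \<otimes> L_factors ps) \<otimes> T_of_perm d)"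
    using car F W(1) by (simp add: finsum_ldistr finsum_rdistr)
  then have "\<tau> (T_word (rev is) \<otimes> ((\<Oplus>w\<in>W. T_of_perm w) \<otimes> L_factors ps) \<otimes> T_of_perm d) =
    (\<Sum>w\<in>W. \<tau> (T_word (rev is) \<otimes> (T_of_perm w \<otimes> L_factors ps) \<otimes> T_of_perm d))"
    using car F W(1) by (simp add: \<tau>_finsum)
  also have "\<dots> = (\<Sum>w\<in>W. (\<Prod>p\<leftarrow>ps. - snd p) * (if d \<circ> w = perm_of_word is then q ^ length is else 0))"
  proof (rule sum.cong[OF refl])
    fix w assume w: "w \<in> W"
    have "\<tau> (T_word (rev is) \<otimes> (T_of_perm w \<otimes> L_factors ps) \<otimes> T_of_perm d) =
      (\<Prod>p\<leftarrow>ps. - snd p) * \<tau> (T_word (rev is) \<otimes> T_of_perm w \<otimes> T_of_perm d)"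
      by (rule \<tau>_constant_term[OF ps le set_is(1) W(2)[OF w] d])
    also have "T_word (rev is) \<otimes> T_of_perm w \<otimes> T_of_perm d =
        T_word (rev is) \<otimes> T_of_perm (d \<circ> w)"
      using car w T_of_perm_mult[OF d W(2)[OF w] add[OF w]] by (simp add: m_assoc)
    finally show "\<tau> (T_word (rev is) \<otimes> (T_of_perm w \<otimes> L_factors ps) \<otimes> T_of_perm d) =
      (\<Prod>p\<leftarrow>ps. - snd p) * (if d \<circ> w = perm_of_word is then q ^ length is else 0)"
      by (simp only: \<tau>_rev_word[OF "is" permutes_compose[OF W(2)[OF w] d]])
  qed
  finally show ?thesis by (simp add: sum_distrib_left)
qed

end

section \<open>Reading order on diagrams\<close>

lemma sum_list_take_mono: "i \<le> j \<Longrightarrow> sum_list (take i xs) \<le> sum_list (take j (xs :: nat list))"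
  using sum_list_append[of "take i xs" "take (j - i) (drop i xs)"] take_add[of i "j - i" xs] by simp

lemma sum_list_take_le: "sum_list (take i xs) \<le> sum_list (xs :: nat list)"
  by (metis append_take_drop_id le_add1 sum_list_append)

lemma sum_list_take_Suc:
  "i < length xs \<Longrightarrow> sum_list (take (Suc i) xs) = sum_list (take i xs) + (xs ! i :: nat)"
  by (simp add: take_Suc_conv_app_nth)

lemma ex_block:
  assumes "1 \<le> j" "j \<le> sum_list (xs :: nat list)"
  shows "\<exists>i<length xs. sum_list (take i xs) < j \<and> j \<le> sum_list (take (Suc i) xs)"
proof -
  define i where "i = (LEAST i. j \<le> sum_list (take i xs))"
  have ex: "j \<le> sum_list (take (length xs) xs)" using assms by simp
  then have le: "j \<le> sum_list (take i xs)" "i \<le> length xs"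
    unfolding i_def by (rule LeastI) (rule Least_le, rule ex)
  then obtain i' where i': "i = Suc i'" using assms by (cases i) auto
  then have "\<not> j \<le> sum_list (take i' xs)"
    using not_less_Least[of i' "\<lambda>i. j \<le> sum_list (take i xs)"] by (simp add: i_def)
  with le i' show ?thesis by (intro exI[of _ i']) auto
qed

lemma mp_size_take: "mp_size (take i \<Lambda>) = sum_list (take i (map sum_list \<Lambda>))"
  by (simp add: mp_size_def take_map)

lemma mp_size_concat: "sum_list (concat \<Lambda>) = mp_size \<Lambda>"
  by (induction \<Lambda>) (simp_all add: mp_size_def)

text \<open>This order refers to nodes alone. It thereby connects the initial tableaux of a shape
  and of a smaller shape, whose entries at a common node may differ.\<close>

fun read_less :: "node \<Rightarrow> node \<Rightarrow> bool" where
  "read_less (r, c, l) (r', c', l') \<longleftrightarrow> l < l' \<or> l = l' \<and> (r < r' \<or> r = r' \<and> c < c')"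

lemma read_less_linear: "x = y \<or> read_less x y \<or> read_less y x"
  by (cases x; cases y) auto

lemma row_end_le:
  assumes "(r, c, l) \<in> diagram \<Lambda>"
  shows "sum_list (take (r - 1) (\<Lambda> ! (l - 1))) + c \<le> sum_list (take r (\<Lambda> ! (l - 1)))"
  using assms sum_list_take_Suc[of "r - 1" "\<Lambda> ! (l - 1)"] by (auto simp: diagram_def)

lemma component_end_le:
  assumes "(r, c, l) \<in> diagram \<Lambda>"
  shows "initial_tableau \<Lambda> (r, c, l) \<le> mp_size (take l \<Lambda>)"
proof -
  have "mp_size (take l \<Lambda>) = mp_size (take (l - 1) \<Lambda>) + sum_list (\<Lambda> ! (l - 1))"
    using sum_list_take_Suc[of "l - 1" "map sum_list \<Lambda>"] assms
    by (auto simp: mp_size_take diagram_def)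
  then show ?thesis
    using row_end_le[OF assms] sum_list_take_le[of r "\<Lambda> ! (l - 1)"] assms
    by (simp add: initial_tableau_def)
qed

lemma initial_tableau_strict_mono:
  assumes "x \<in> diagram \<Lambda>" "y \<in> diagram \<Lambda>" "read_less x y"
  shows "initial_tableau \<Lambda> x < initial_tableau \<Lambda> y"
proof -
  obtain r c l r' c' l' where xy: "x = (r, c, l)" "y = (r', c', l')"
    by (cases x; cases y) auto
  have c': "1 \<le> c'" using assms by (auto simp: xy diagram_def)
  consider "l < l'" | "l = l'" "r < r'" | "l = l'" "r = r'" "c < c'"
    using assms by (auto simp: xy)
  then show ?thesis
  proof cases
    case 1
    then have "mp_size (take l \<Lambda>) \<le> mp_size (take (l' - 1) \<Lambda>)"
      unfolding mp_size_take by (intro sum_list_take_mono) simp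
    then show ?thesis
      using component_end_le[of r c l \<Lambda>] assms c' by (simp add: xy initial_tableau_def)
  next
    case 2
    then have "sum_list (take r (\<Lambda> ! (l - 1))) \<le> sum_list (take (r' - 1) (\<Lambda> ! (l - 1)))"
      by (intro sum_list_take_mono) simp
    then show ?thesis
      using row_end_le[of r c l \<Lambda>] 2 assms c' by (simp add: xy initial_tableau_def)
  next
    case 3
    then show ?thesis using assms by (simp add: xy initial_tableau_def)
  qed
qed

lemma initial_tableau_less_iff:
  assumes "x \<in> diagram \<Lambda>" "y \<in> diagram \<Lambda>"
  shows "initial_tableau \<Lambda> x < initial_tableau \<Lambda> y \<longleftrightarrow> read_less x y"
  using initial_tableau_strict_mono[OF assms] initial_tableau_strict_mono[OF assms(2,1)]
    read_less_linear[of x y] by fastforce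

lemma initial_tableau_bij: "bij_betw (initial_tableau \<Lambda>) (diagram \<Lambda>) {1..mp_size \<Lambda>}"
proof (rule bij_betw_imageI)
  show "inj_on (initial_tableau \<Lambda>) (diagram \<Lambda>)"
    using initial_tableau_strict_mono read_less_linear by (metis inj_onI less_irrefl)
  show "initial_tableau \<Lambda> ` diagram \<Lambda> = {1..mp_size \<Lambda>}"
  proof (intro equalityI subsetI)
    fix j assume "j \<in> initial_tableau \<Lambda> ` diagram \<Lambda>"
    then obtain r c l where x: "(r, c, l) \<in> diagram \<Lambda>" "j = initial_tableau \<Lambda> (r, c, l)"
      by auto
    have "mp_size (take l \<Lambda>) \<le> mp_size \<Lambda>"
      unfolding mp_size_take unfolding mp_size_def by (rule sum_list_take_le)
    moreover have "1 \<le> j" using x by (simp add: initial_tableau_def diagram_def)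
    ultimately show "j \<in> {1..mp_size \<Lambda>}"
      using component_end_le[OF x(1)] x(2) by simp
  next
    fix j assume "j \<in> {1..mp_size \<Lambda>}"
    then have "1 \<le> j" "j \<le> sum_list (map sum_list \<Lambda>)" by (auto simp: mp_size_def)
    from ex_block[OF this] obtain l where l: "l < length \<Lambda>"
      "sum_list (take l (map sum_list \<Lambda>)) < j" "j \<le> sum_list (take (Suc l) (map sum_list \<Lambda>))"
      by auto
    let ?p = "\<Lambda> ! l" and ?j = "j - sum_list (take l (map sum_list \<Lambda>))"
    have "1 \<le> ?j" "?j \<le> sum_list ?p"
      using l sum_list_take_Suc[of l "map sum_list \<Lambda>"] by auto
    from ex_block[OF this] obtain r where r: "r < length ?p"
      "sum_list (take r ?p) < ?j" "?j \<le> sum_list (take (Suc r) ?p)"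
      by blast
    \<comment> \<open>\<open>l\<close> and \<open>r\<close> are list positions counted from 0,
      whereas components and rows of nodes are counted from 1.\<close>
    let ?x = "(Suc r, ?j - sum_list (take r ?p), Suc l)"
    have "?x \<in> diagram \<Lambda>"
      using l r sum_list_take_Suc[of r ?p] by (auto simp: diagram_def)
    moreover from this have "initial_tableau \<Lambda> ?x = j"
      using l r by (simp add: initial_tableau_def mp_size_take)
    ultimately show "j \<in> initial_tableau \<Lambda> ` diagram \<Lambda>" by (rule rev_image_eqI[OF _ sym])
  qed
qed

lemma finite_diagram [simp]: "finite (diagram \<Lambda>)"
  using initial_tableau_bij[of \<Lambda>] bij_betw_finite by blast

lemma card_diagram: "card (diagram \<Lambda>) = mp_size \<Lambda>"
  using bij_betw_same_card[OF initial_tableau_bij[of \<Lambda>]] by simp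

lemma diagram_take:
  assumes "i \<le> length \<Lambda>"
  shows "diagram (take i \<Lambda>) = {x \<in> diagram \<Lambda>. snd (snd x) \<le> i}"
  using assms by (auto simp: diagram_def)

section \<open>Young subgroups\<close>

text \<open>For \<open>a = concat \<Lambda>\<close> a block consists of the entries of the initial
  tableau in one row.\<close>

definition block :: "nat list \<Rightarrow> nat \<Rightarrow> nat set" where
  "block a i = {sum_list (take i a)<..sum_list (take (Suc i) a)}"

text \<open>For permutations \<open>d\<close> this describes the shortest elements of the cosets
  formed by all \<open>d \<circ> w\<close> with \<open>w\<close> in the Young subgroup.\<close>

definition block_increasing :: "nat list \<Rightarrow> (nat \<Rightarrow> nat) \<Rightarrow> bool" where
  "block_increasing a d \<longleftrightarrow>
    (\<forall>i<length a. \<forall>j\<in>block a i. \<forall>k\<in>block a i. j < k \<longrightarrow> d j < d k)"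

lemma young_subgroup_permutes: "w \<in> young_subgroup a \<Longrightarrow> w permutes {1..sum_list a}"
  by (simp add: young_subgroup_def)

lemma finite_young_subgroup: "finite (young_subgroup a)"
  by (rule finite_subset[OF _ finite_permutations[of "{1..sum_list a}"]])
     (auto simp: young_subgroup_def)

lemma id_in_young_subgroup: "id \<in> young_subgroup a"
  by (auto simp: young_subgroup_def permutes_id)

lemma block_less:
  assumes "j \<in> block a i" "k \<in> block a i'" "i < i'"
  shows "j < k"
  using assms sum_list_take_mono[of "Suc i" i' a] by (auto simp: block_def)

text \<open>Both blocks are preserved by \<open>w\<close> and blocks follow one another in order, so
  entries of different blocks are never inverted.\<close>

lemma young_subgroup_inversion:
  assumes w: "w \<in> young_subgroup a" and jk: "j < k" "w k < w j"
  shows "\<exists>i<length a. {j, k, w j, w k} \<subseteq> block a i"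
proof -
  let ?N = "sum_list a"
  note perm = young_subgroup_permutes[OF w]
  have out: "w x = x" if "x \<notin> {1..?N}" for x
    using permutes_not_in[OF perm that] .
  have "in": "w x \<in> {1..?N} \<longleftrightarrow> x \<in> {1..?N}" for x
    using permutes_in_image[OF perm] .
  \<comment> \<open>Outside the range \<open>w\<close> is the identity, and inside it stays inside;
    an inverted pair therefore lies in the range.\<close>
  have "j \<in> {1..?N}" "k \<in> {1..?N}"
    using jk out[of j] out[of k] "in"[of j] "in"[of k] by auto
  then obtain i i' where i: "i < length a" "j \<in> block a i" and i': "i' < length a" "k \<in> block a i'"
    using ex_block[of j a] ex_block[of k a] unfolding block_def by auto
  have img: "w ` block a i = block a i" if "i < length a" for i
    using w that by (simp add: young_subgroup_def block_def)
  have wi: "w j \<in> block a i" "w k \<in> block a i'"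
    using img[OF i(1)] img[OF i'(1)] i i' by auto
  have "i = i'"
    using block_less[OF i(2) i'(2)] block_less[OF i'(2) i(2)] block_less[OF wi] jk
    by (cases i i' rule: linorder_cases) auto
  then show ?thesis using i i' wi by blast
qed

lemma block_increasing_inversion:
  assumes "w \<in> young_subgroup a" "block_increasing a d" "j < k" "w k < w j"
  shows "d (w k) < d (w j)"
  using young_subgroup_inversion[OF assms(1,3,4)] assms(2,4) by (auto simp: block_increasing_def)

text \<open>A descent of \<open>w\<close> takes place within a block. There \<open>d\<close> and
  \<open>d \<circ> w\<close> would order the two values in opposite ways, so \<open>w\<close> has no
  descent.\<close>

lemma block_increasing_coset:
  assumes w: "w \<in> young_subgroup a" and d: "block_increasing a d" "block_increasing a (d \<circ> w)"
  shows "w = id"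
proof (rule strict_mono_permutes_id[OF young_subgroup_permutes[OF w]])
  fix i
  show "w i < w (Suc i)"
  proof (rule ccontr)
    assume "\<not> ?thesis"
    then have less: "w (Suc i) < w i"
      using permutes_ascent_or_descent[OF young_subgroup_permutes[OF w]] by blast
    then obtain b where "b < length a" "{i, Suc i, w i, w (Suc i)} \<subseteq> block a b"
      using young_subgroup_inversion[OF w, of i "Suc i"] by blast
    then have "d (w (Suc i)) < d (w i)" "d (w i) < d (w (Suc i))"
      using d less unfolding block_increasing_def by auto
    then show False by simp
  qed
qed

lemma sum_young_subgroup_coset:
  assumes "block_increasing a d" "block_increasing a d'"
  shows "(\<Sum>w\<in>young_subgroup a. if d \<circ> w = d' then x else 0) = (if d = d' then x else 0)"
proof -
  have "(d \<circ> w = d') \<longleftrightarrow> (w = id \<and> d = d')" if "w \<in> young_subgroup a" for w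
    using block_increasing_coset[OF that assms(1)] assms(2) by auto
  then have "(\<Sum>w\<in>young_subgroup a. if d \<circ> w = d' then x else 0) =
      (\<Sum>w\<in>young_subgroup a. if w = id then (if d = d' then x else 0) else 0)"
    by (intro sum.cong) auto
  also have "\<dots> = (if d = d' then x else 0)"
    using id_in_young_subgroup finite_young_subgroup by simp
  finally show ?thesis .
qed

text \<open>Needed to pass from a part of the concatenated list to a component and a row; the offset
  has the form used in \<open>initial_tableau\<close>.\<close>

lemma block_concat:
  assumes "i < length (concat \<Lambda>)"
  shows "\<exists>l r. l < length \<Lambda> \<and> r < length (\<Lambda> ! l) \<and> concat \<Lambda> ! i = \<Lambda> ! l ! r \<and>
    sum_list (take i (concat \<Lambda>)) = mp_size (take l \<Lambda>) + sum_list (take r (\<Lambda> ! l))"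
  using assms
proof (induction \<Lambda> arbitrary: i)
  case (Cons p \<Lambda>)
  show ?case
  proof (cases "i < length p")
    case True
    then show ?thesis
      by (intro exI[of _ 0] exI[of _ i]) (simp add: nth_append mp_size_def)
  next
    case False
    with Cons obtain l r where "l < length \<Lambda>" "r < length (\<Lambda> ! l)"
      "concat \<Lambda> ! (i - length p) = \<Lambda> ! l ! r"
      "sum_list (take (i - length p) (concat \<Lambda>)) = mp_size (take l \<Lambda>) + sum_list (take r (\<Lambda> ! l))"
      by (metis concat.simps(2) length_append nat_add_left_cancel_less le_add_diff_inverse not_less)
    then show ?thesis using False
      by (intro exI[of _ "Suc l"] exI[of _ r]) (simp add: nth_append mp_size_def)
  qed
qed simp

section \<open>Standard tableaux\<close>

lemma tableau_bij: "t \<in> tableaux \<Lambda> \<Longrightarrow> bij_betw t (diagram \<Lambda>) {1..mp_size \<Lambda>}"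
  by (simp add: tableaux_def)

lemma standard_tableaux_tableaux: "t \<in> standard_tableaux \<Lambda> \<Longrightarrow> t \<in> tableaux \<Lambda>"
  by (simp add: standard_tableaux_def)

lemma tableau_perm:
  assumes t: "t \<in> tableaux \<Lambda>"
  shows "tableau_perm \<Lambda> t permutes {1..mp_size \<Lambda>}"
    and "\<And>x. x \<in> diagram \<Lambda> \<Longrightarrow> tableau_perm \<Lambda> t (initial_tableau \<Lambda> x) = t x"
proof -
  let ?D = "diagram \<Lambda>" and ?I = "initial_tableau \<Lambda>" and ?N = "{1..mp_size \<Lambda>}"
  let ?P = "\<lambda>d. d permutes ?N \<and> (\<forall>x\<in>?D. t x = d (?I x))"
  \<comment> \<open>The tableau fixes the values on \<open>?N\<close>; elsewhere
    \<open>permutes\<close> demands the identity, which also gives uniqueness.\<close>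
  define d where "d = (\<lambda>j. if j \<in> ?N then t (inv_into ?D ?I j) else j)"
  have "bij_betw (t \<circ> inv_into ?D ?I) ?N ?N"
    by (rule bij_betw_trans[OF bij_betw_inv_into[OF initial_tableau_bij] tableau_bij[OF t]])
  then have "bij_betw d ?N ?N"
    by (rule bij_betw_cong[THEN iffD1, rotated]) (simp add: d_def)
  then have perm: "d permutes ?N"
    by (rule bij_imp_permutes) (auto simp: d_def)
  have inj: "inj_on ?I ?D" and img: "?I ` ?D = ?N"
    using initial_tableau_bij[of \<Lambda>] by (auto simp: bij_betw_def)
  have "t x = d (?I x)" if "x \<in> ?D" for x
    using inv_into_f_f[OF inj that] img that by (auto simp: d_def)
  with perm have "?P d" by blast
  moreover have "e = d" if "?P e" for e
  proof
    fix j
    show "e j = d j"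
    proof (cases "j \<in> ?N")
      case True
      then obtain x where "x \<in> ?D" "j = ?I x" using img by blast
      then show ?thesis using that \<open>?P d\<close> by metis
    next
      case False
      then show ?thesis using that \<open>?P d\<close> permutes_not_in by metis
    qed
  qed
  ultimately have "?P (tableau_perm \<Lambda> t)"
    unfolding tableau_perm_def by (rule theI)
  then show "tableau_perm \<Lambda> t permutes ?N" "\<And>x. x \<in> ?D \<Longrightarrow> tableau_perm \<Lambda> t (?I x) = t x"
    by simp_all
qed

lemma tableau_perm_inj:
  assumes "s \<in> tableaux \<Lambda>" "t \<in> tableaux \<Lambda>" "tableau_perm \<Lambda> s = tableau_perm \<Lambda> t"
  shows "s = t"
proof (rule extensionalityI)
  show "s x = t x" if "x \<in> diagram \<Lambda>" for x
    using tableau_perm(2)[OF assms(1) that] tableau_perm(2)[OF assms(2) that] assms(3) by simp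
qed (use assms in \<open>auto simp: tableaux_def\<close>)

text \<open>A block is a row of the initial tableau, and \<open>tableau_perm\<close> sends its
  entries to those of \<open>t\<close> in the same row, which increase.\<close>

lemma block_increasing_tableau_perm:
  assumes t: "t \<in> standard_tableaux \<Lambda>"
  shows "block_increasing (concat \<Lambda>) (tableau_perm \<Lambda> t)"
  unfolding block_increasing_def
proof (intro allI ballI impI)
  fix i j k assume i: "i < length (concat \<Lambda>)"
    and jk: "j \<in> block (concat \<Lambda>) i" "k \<in> block (concat \<Lambda>) i" "j < k"
  obtain l r where lr: "l < length \<Lambda>" "r < length (\<Lambda> ! l)" "concat \<Lambda> ! i = \<Lambda> ! l ! r"
    "sum_list (take i (concat \<Lambda>)) = mp_size (take l \<Lambda>) + sum_list (take r (\<Lambda> ! l))"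
    using block_concat[OF i] by blast
  let ?o = "sum_list (take i (concat \<Lambda>))"
  let ?x = "\<lambda>j. (Suc r, j - ?o, Suc l)"
  have node: "?x j \<in> diagram \<Lambda>" "initial_tableau \<Lambda> (?x j) = j" if "j \<in> block (concat \<Lambda>) i" for j
  proof -
    have "?o < j" "j \<le> ?o + \<Lambda> ! l ! r"
      using that sum_list_take_Suc[OF i] lr(3) by (auto simp: block_def)
    then show "?x j \<in> diagram \<Lambda>"
      using lr by (auto simp: diagram_def)
    then show "initial_tableau \<Lambda> (?x j) = j"
      using \<open>?o < j\<close> lr(4) by (simp add: initial_tableau_def)
  qed
  have "j - ?o < k - ?o" using jk by (auto simp: block_def)
  then have "t (?x j) < t (?x k)"
    using t node(1)[OF jk(1)] node(1)[OF jk(2)] unfolding standard_tableaux_def by blast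
  then show "tableau_perm \<Lambda> t j < tableau_perm \<Lambda> t k"
    using tableau_perm(2)[OF standard_tableaux_tableaux[OF t]] node jk by metis
qed

section \<open>Shapes of subtableaux\<close>

text \<open>As parts are nonzero, every row has a node in column 1, so the diagram shows the number
  of rows as well as their lengths.\<close>

lemma multipartition_eqI:
  assumes M: "M \<in> multipartitions ell k" and M': "M' \<in> multipartitions ell k'"
    and D: "diagram M = diagram M'"
  shows "M = M'"
proof (rule nth_equalityI)
  show "length M = length M'" using M M' by (simp add: multipartitions_def)
  fix l assume l: "l < length M"
  then have l': "l < length M'" using M M' by (simp add: multipartitions_def)
  have mem: "(Suc r, c, Suc l) \<in> diagram M \<longleftrightarrow> r < length (M ! l) \<and> 1 \<le> c \<and> c \<le> M ! l ! r"
    "(Suc r, c, Suc l) \<in> diagram M' \<longleftrightarrow> r < length (M' ! l) \<and> 1 \<le> c \<and> c \<le> M' ! l ! r" for r c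
    using l l' by (auto simp: diagram_def)
  have pos: "1 \<le> M ! l ! r" if "r < length (M ! l)" for r
  proof -
    have "0 \<notin> set (M ! l)" using M nth_mem[OF l] by (auto simp: multipartitions_def)
    then show ?thesis using nth_mem[OF that] by (cases "M ! l ! r") auto
  qed
  have pos': "1 \<le> M' ! l ! r" if "r < length (M' ! l)" for r
  proof -
    have "0 \<notin> set (M' ! l)" using M' nth_mem[OF l'] by (auto simp: multipartitions_def)
    then show ?thesis using nth_mem[OF that] by (cases "M' ! l ! r") auto
  qed
  have iff: "r < length (M ! l) \<and> 1 \<le> c \<and> c \<le> M ! l ! r \<longleftrightarrow>
    r < length (M' ! l) \<and> 1 \<le> c \<and> c \<le> M' ! l ! r" for r c
    using D mem by blast
  have len: "r < length (M ! l) \<longleftrightarrow> r < length (M' ! l)" for r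
    using iff[of r 1] pos pos' by auto
  show "M ! l = M' ! l"
  proof (rule nth_equalityI)
    show "length (M ! l) = length (M' ! l)"
      using len by (meson linorder_neqE_nat less_irrefl)
    fix r assume r: "r < length (M ! l)"
    then show "M ! l ! r = M' ! l ! r"
      using iff[of r "M ! l ! r"] iff[of r "M' ! l ! r"] pos[of r] pos'[of r] len[of r]
      by (simp add: le_antisym)
  qed
qed

lemma initial_segment_card:
  assumes "finite (S :: nat set)" "0 \<notin> S" "\<And>c c'. c \<in> S \<Longrightarrow> 1 \<le> c' \<Longrightarrow> c' \<le> c \<Longrightarrow> c' \<in> S"
  shows "S = {1..card S}"
proof (cases "S = {}")
  case False
  have "S = {1..Max S}"
  proof (intro equalityI subsetI)
    fix c assume "c \<in> S"
    then show "c \<in> {1..Max S}" using assms(1,2) by (cases c) auto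
  next
    fix c assume "c \<in> {1..Max S}"
    then show "c \<in> S" using assms(3)[OF Max_in[OF assms(1) False], of c] by simp
  qed
  then show ?thesis by (metis card_atLeastAtMost diff_Suc_1)
qed simp

text \<open>Closure to the left and upwards makes each row and the first column an initial segment.
  Their cardinalities \<open>f l r\<close> and \<open>h l\<close> are the row lengths and the
  numbers of rows, and rows shrink because each lies above the next.\<close>

lemma ex_shape:
  assumes fin: "finite D"
    and bound: "\<And>r c l. (r, c, l) \<in> D \<Longrightarrow> 1 \<le> r \<and> 1 \<le> c \<and> 1 \<le> l \<and> l \<le> ell"
    and down: "\<And>r c l r' c'. (r, c, l) \<in> D \<Longrightarrow> 1 \<le> r' \<Longrightarrow> r' \<le> r \<Longrightarrow> 1 \<le> c' \<Longrightarrow> c' \<le> c \<Longrightarrow>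
      (r', c', l) \<in> D"
  shows "\<exists>M \<in> multipartitions ell (card D). diagram M = D"
proof -
  define f where "f l r = card {c. (r, c, l) \<in> D}" for l r
  define h where "h l = card {r. (r, 1, l) \<in> D}" for l
  have finc: "finite {c. (r, c, l) \<in> D}" for r l
    by (rule finite_subset[of _ "(fst \<circ> snd) ` D"]) (use fin in force)+
  have finr: "finite {r. (r, 1, l) \<in> D}" for l
    by (rule finite_subset[of _ "fst ` D"]) (use fin in force)+
  have f: "{c. (r, c, l) \<in> D} = {1..f l r}" for r l
    unfolding f_def
  proof (rule initial_segment_card[OF finc])
    show "0 \<notin> {c. (r, c, l) \<in> D}" using bound[of r 0 l] by auto
    show "c' \<in> {c. (r, c, l) \<in> D}" if "c \<in> {c. (r, c, l) \<in> D}" "1 \<le> c'" "c' \<le> c" for c c'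
      using that down[of r c l r c'] bound[of r c l] by simp
  qed
  have h: "{r. (r, 1, l) \<in> D} = {1..h l}" for l
    unfolding h_def
  proof (rule initial_segment_card[OF finr])
    show "0 \<notin> {r. (r, 1, l) \<in> D}" using bound[of 0 1 l] by auto
    show "r' \<in> {r. (r, 1, l) \<in> D}" if "r \<in> {r. (r, 1, l) \<in> D}" "1 \<le> r'" "r' \<le> r" for r r'
      using that down[of r 1 l r' 1] by simp
  qed
  define M where "M = map (\<lambda>l. map (f l) [1..<Suc (h l)]) [1..<Suc ell]"
  have len: "length M = ell" by (simp add: M_def)
  have nth: "M ! (l - 1) = map (f l) [1..<Suc (h l)]" if "1 \<le> l" "l \<le> ell" for l
    using that by (cases l) (simp_all add: M_def del: upt_Suc)
  \<comment> \<open>A node in row \<open>r\<close> forces the node in column 1 of that row, whence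
    \<open>r \<le> h l\<close>.\<close>
  have memD: "(r, c, l) \<in> D \<longleftrightarrow> 1 \<le> l \<and> l \<le> ell \<and> 1 \<le> r \<and> r \<le> h l \<and> 1 \<le> c \<and> c \<le> f l r" for r c l
    using f[of r l] h[of l] bound[of r c l] down[of r c l r 1] by (auto simp: set_eq_iff)
  have diag: "diagram M = D"
  proof (rule Set.set_eqI)
    fix x :: node
    obtain r c l where x: "x = (r, c, l)" by (cases x)
    have "length (M ! (l - 1)) = h l" "\<And>r. 1 \<le> r \<Longrightarrow> r \<le> h l \<Longrightarrow> M ! (l - 1) ! (r - 1) = f l r"
      if "1 \<le> l" "l \<le> ell"
      unfolding nth[OF that] by (auto simp del: upt_Suc)
    then show "x \<in> diagram M \<longleftrightarrow> x \<in> D"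
      unfolding x memD diagram_def len by (auto simp del: One_nat_def)
  qed
  have "sorted_wrt (\<ge>) (map (f l) [1..<Suc (h l)])" for l
  proof -
    have "f l r' \<le> f l r" if "1 \<le> r" "r < r'" for r r'
      unfolding f_def
    proof (rule card_mono[OF finc], rule subsetI)
      show "c \<in> {c. (r, c, l) \<in> D}" if "c \<in> {c. (r', c, l) \<in> D}" for c
        using that \<open>1 \<le> r\<close> \<open>r < r'\<close> down[of r' c l r c] bound[of r' c l] by simp
    qed
    then show ?thesis
      by (auto simp: sorted_wrt_iff_nth_less simp del: upt_Suc)
  qed
  moreover have "0 \<notin> set (map (f l) [1..<Suc (h l)])" for l
  proof
    assume "0 \<in> set (map (f l) [1..<Suc (h l)])"
    then obtain r where r: "1 \<le> r" "r \<le> h l" "f l r = 0" by auto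
    then have "r \<in> {r. (r, 1, l) \<in> D}" unfolding h by simp
    then have "(r, 1, l) \<in> D" by simp
    then show False using f[of r l] r by auto
  qed
  moreover have "mp_size M = card D"
    using card_diagram[of M] diag by simp
  ultimately have "M \<in> multipartitions ell (card D)"
    unfolding multipartitions_def by (auto simp: len M_def simp del: upt_Suc)
  with diag show ?thesis by blast
qed

text \<open>Resolves the definite description. Standardness makes the nodes with entries at most
  \<open>k\<close> closed to the left and upwards, \<open>ex_shape\<close> then gives a shape, and
  \<open>multipartition_eqI\<close> its uniqueness.\<close>

lemma sub_shape:
  assumes \<Lambda>: "\<Lambda> \<in> multipartitions ell n" and t: "t \<in> standard_tableaux \<Lambda>" and k: "k \<le> n"
  shows "mp_size (sub_shape \<Lambda> t k) = k" "diagram (sub_shape \<Lambda> t k) = {x \<in> diagram \<Lambda>. t x \<le> k}"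
proof -
  let ?D = "{x \<in> diagram \<Lambda>. t x \<le> k}"
  have size: "mp_size \<Lambda> = n" "length \<Lambda> = ell"
    using \<Lambda> by (auto simp: multipartitions_def)
  have down: "(r', c', l) \<in> ?D" if "(r, c, l) \<in> ?D" "1 \<le> r'" "r' \<le> r" "1 \<le> c'" "c' \<le> c" for r c l r' c'
  proof -
    have rcl: "(r, c, l) \<in> diagram \<Lambda>" "t (r, c, l) \<le> k" using that by auto
    have "sorted_wrt (\<ge>) (\<Lambda> ! (l - 1))"
      using \<Lambda> rcl(1) by (auto simp: multipartitions_def diagram_def)
    then have "\<Lambda> ! (l - 1) ! (r - 1) \<le> \<Lambda> ! (l - 1) ! (r' - 1)"
      using rcl(1) that(2,3) sorted_wrt_nth_less[of "(\<ge>)" "\<Lambda> ! (l - 1)" "r' - 1" "r - 1"]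
      by (cases "r = r'") (auto simp: diagram_def)
    then have mem: "(r', c', l) \<in> diagram \<Lambda>" "(r', c, l) \<in> diagram \<Lambda>"
      using rcl(1) that by (auto simp: diagram_def)
    have "t (r', c', l) \<le> t (r', c, l)"
      using t mem that(5) unfolding standard_tableaux_def by (cases "c' = c") (auto simp: less_imp_le)
    also have "\<dots> \<le> t (r, c, l)"
      using t mem rcl that(3) unfolding standard_tableaux_def by (cases "r' = r") (auto simp: less_imp_le)
    finally show ?thesis using mem rcl by simp
  qed
  have bij: "bij_betw t (diagram \<Lambda>) {1..n}"
    using tableau_bij[OF standard_tableaux_tableaux[OF t]] size by simp
  have "t ` ?D = {1..k}"
  proof (intro equalityI subsetI)
    show "j \<in> {1..k}" if "j \<in> t ` ?D" for j
      using that bij_betw_imp_surj_on[OF bij] by auto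
    show "j \<in> t ` ?D" if "j \<in> {1..k}" for j
    proof -
      have "j \<in> t ` diagram \<Lambda>" using that k bij_betw_imp_surj_on[OF bij] by auto
      then show ?thesis using that by auto
    qed
  qed
  moreover have "inj_on t ?D"
    using bij_betw_imp_inj_on[OF bij] by (rule inj_on_subset) auto
  ultimately have card: "card ?D = k"
    using card_image[of t ?D] by simp
  obtain M where M: "M \<in> multipartitions ell k" "diagram M = ?D"
  proof -
    have "\<exists>M \<in> multipartitions ell (card ?D). diagram M = ?D"
    proof (rule ex_shape)
      show "1 \<le> r \<and> 1 \<le> c \<and> 1 \<le> l \<and> l \<le> ell" if "(r, c, l) \<in> ?D" for r c l
        using that size by (auto simp: diagram_def)
      show "(r', c', l) \<in> ?D" if "(r, c, l) \<in> ?D" "1 \<le> r'" "r' \<le> r" "1 \<le> c'" "c' \<le> c"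
        for r c l r' c'
        using that by (rule down)
    qed simp
    with that card show thesis by auto
  qed
  have "sub_shape \<Lambda> t k \<in> multipartitions (length \<Lambda>) k \<and> diagram (sub_shape \<Lambda> t k) = ?D"
    unfolding sub_shape_def size
  proof (rule theI)
    show "M \<in> multipartitions ell k \<and> diagram M = ?D" using M by blast
    show "N = M" if "N \<in> multipartitions ell k \<and> diagram N = ?D" for N
      using multipartition_eqI[of N ell k M k] that M by simp
  qed
  then show "mp_size (sub_shape \<Lambda> t k) = k" "diagram (sub_shape \<Lambda> t k) = ?D"
    by (auto simp: multipartitions_def)
qed

text \<open>
  Both \<open>t\<close> restricted to \<open>{1, \<dots>, k}\<close> and \<open>t\<close> itself read their nodes in the same order, so
  \<open>k - k(t)\<close> counts the inversions whose larger value is \<open>k\<close>.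
\<close>

lemma last_index_inversions:
  assumes \<Lambda>: "\<Lambda> \<in> multipartitions ell n" and t: "t \<in> standard_tableaux \<Lambda>"
    and x: "x \<in> diagram \<Lambda>" "t x = k"
  shows "k - last_index (sub_shape \<Lambda> t k) (sub_tableau \<Lambda> t k) =
    card {y \<in> diagram \<Lambda>. t y < t x \<and> initial_tableau \<Lambda> x < initial_tableau \<Lambda> y}"
proof -
  let ?M = "sub_shape \<Lambda> t k" and ?u = "sub_tableau \<Lambda> t k" and ?D = "{x \<in> diagram \<Lambda>. t x \<le> k}"
  have bij: "bij_betw t (diagram \<Lambda>) {1..n}"
    using tableau_bij[OF standard_tableaux_tableaux[OF t]] \<Lambda> by (simp add: multipartitions_def)
  then have k: "1 \<le> k" "k \<le> n" using x by (auto dest: bij_betwE)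
  note M = sub_shape[OF \<Lambda> t k(2)]
  have inj: "inj_on t (diagram \<Lambda>)" using bij by (rule bij_betw_imp_inj_on)
  have xD: "x \<in> ?D" using x by simp
  have "inj_on ?u ?D"
    using inj unfolding sub_tableau_def by (intro inj_onI) (auto dest: inj_onD)
  then have pos: "position ?M ?u k = x"
    using inv_into_f_f[of ?u ?D x] xD x(2) unfolding position_def M by (simp add: sub_tableau_def)
  let ?I = "initial_tableau ?M"
  have bijI: "bij_betw ?I ?D {1..k}"
    using initial_tableau_bij[of ?M] by (simp only: M)
  have injI: "inj_on ?I ?D" and imgI: "?I ` ?D = {1..k}"
    using bijI by (auto simp: bij_betw_def)
  have "last_index ?M ?u = ?I x"
    unfolding last_index_def M pos
  proof (rule the_equality)
    show "?I x \<in> {1..k} \<and> x = position ?M ?I (?I x)"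
      using xD imgI inv_into_f_f[OF injI xD] unfolding position_def M by auto
    show "j = ?I x" if "j \<in> {1..k} \<and> x = position ?M ?I j" for j
      using that imgI f_inv_into_f[of j ?I ?D] unfolding position_def M by simp
  qed
  \<comment> \<open>The nodes read after \<open>x\<close> carry the entries of \<open>?I\<close>
    above \<open>?I x\<close>, up to \<open>k\<close>.\<close>
  moreover have "card {y \<in> ?D. ?I x < ?I y} = k - ?I x"
  proof -
    have "?I ` {y \<in> ?D. ?I x < ?I y} = {?I x<..k}"
    proof (intro equalityI subsetI)
      show "j \<in> {?I x<..k}" if "j \<in> ?I ` {y \<in> ?D. ?I x < ?I y}" for j
        using that imgI by auto
      fix j assume j: "j \<in> {?I x<..k}"
      then have "j \<in> ?I ` ?D" unfolding imgI by simp
      then obtain y where y: "j = ?I y" "y \<in> ?D" by (rule imageE)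
      with j show "j \<in> ?I ` {y \<in> ?D. ?I x < ?I y}" by simp
    qed
    moreover have "inj_on ?I {y \<in> ?D. ?I x < ?I y}"
      using injI by (rule inj_on_subset) auto
    ultimately show ?thesis using card_image by fastforce
  qed
  moreover have "{y \<in> ?D. ?I x < ?I y} =
    {y \<in> diagram \<Lambda>. t y < t x \<and> initial_tableau \<Lambda> x < initial_tableau \<Lambda> y}"
  proof (rule Set.set_eqI)
    fix y
    \<comment> \<open>Entries of the two initial tableaux cannot be compared directly; both orders
      are traced back to \<open>read_less\<close>.\<close>
    have 1: "?I x < ?I y \<longleftrightarrow> read_less x y" if "y \<in> ?D"
      by (rule initial_tableau_less_iff[of x ?M y, unfolded M, OF xD that])
    have 2: "t y \<le> k \<longleftrightarrow> t y < t x" if "y \<in> diagram \<Lambda>" "read_less x y"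
    proof -
      have "\<not> read_less x x" by (cases x) simp
      then have "t y \<noteq> t x" using inj_onD[OF inj _ that(1) x(1)] that(2) by blast
      then show ?thesis using x(2) by auto
    qed
    show "y \<in> {y \<in> ?D. ?I x < ?I y} \<longleftrightarrow>
        y \<in> {y \<in> diagram \<Lambda>. t y < t x \<and> initial_tableau \<Lambda> x < initial_tableau \<Lambda> y}"
      unfolding mem_Collect_eq using 1 2 initial_tableau_less_iff[OF x(1)] x(2)
      by (metis (mono_tags, lifting) less_imp_le mem_Collect_eq)
  qed
  ultimately show ?thesis by simp
qed

text \<open>Sorting inversions by their larger value \<open>t x\<close> makes the sum a count of
  pairs of nodes, which \<open>?I\<close> carries bijectively to pairs of positions.\<close>

lemma inv_count_tableau_perm:
  assumes \<Lambda>: "\<Lambda> \<in> multipartitions ell n" and t: "t \<in> standard_tableaux \<Lambda>"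
  shows "inv_count n (tableau_perm \<Lambda> t) =
    (\<Sum>k=1..n. k - last_index (sub_shape \<Lambda> t k) (sub_tableau \<Lambda> t k))"
proof -
  let ?D = "diagram \<Lambda>" and ?I = "initial_tableau \<Lambda>" and ?d = "tableau_perm \<Lambda> t"
  have size: "mp_size \<Lambda> = n" using \<Lambda> by (simp add: multipartitions_def)
  note T = standard_tableaux_tableaux[OF t]
  have bij: "bij_betw t ?D {1..n}" using tableau_bij[OF T] size by simp
  have bijI: "bij_betw ?I ?D {1..n}" using initial_tableau_bij[of \<Lambda>] size by simp
  have imgI: "?I ` ?D = {1..n}" using bijI by (rule bij_betw_imp_surj_on)
  let ?S = "SIGMA x:?D. {y \<in> ?D. t y < t x \<and> ?I x < ?I y}"
  have "(\<Sum>k=1..n. k - last_index (sub_shape \<Lambda> t k) (sub_tableau \<Lambda> t k)) =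
    (\<Sum>x\<in>?D. t x - last_index (sub_shape \<Lambda> t (t x)) (sub_tableau \<Lambda> t (t x)))"
    by (rule sum.reindex_bij_betw[OF bij, symmetric])
  also have "\<dots> = (\<Sum>x\<in>?D. card {y \<in> ?D. t y < t x \<and> ?I x < ?I y})"
    using last_index_inversions[OF \<Lambda> t] by (intro sum.cong) auto
  also have "\<dots> = card ?S"
    by (rule card_SigmaI[symmetric]) auto
  also have "\<dots> = card (inversions n ?d)"
  proof (rule bij_betw_same_card[of "map_prod ?I ?I"], rule bij_betw_imageI)
    show "inj_on (map_prod ?I ?I) ?S"
      by (rule inj_on_subset[OF map_prod_inj_on[OF bij_betw_imp_inj_on[OF bijI] bij_betw_imp_inj_on[OF bijI]]]) auto
    show "map_prod ?I ?I ` ?S = inversions n ?d"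
    proof (intro equalityI subsetI)
      fix p assume "p \<in> map_prod ?I ?I ` ?S"
      then obtain x y where xy: "x \<in> ?D" "y \<in> ?D" "t y < t x" "?I x < ?I y" "p = (?I x, ?I y)"
        by auto
      then have "?I x \<in> {1..n}" "?I y \<in> {1..n}" using imgI by blast+
      then show "p \<in> inversions n ?d"
        using xy tableau_perm(2)[OF T] by (simp add: inversions_def)
    next
      fix p assume "p \<in> inversions n ?d"
      then obtain a b where p: "p = (a, b)" "1 \<le> a" "a < b" "b \<le> n" "?d b < ?d a"
        by (auto simp: inversions_def)
      then have "a \<in> ?I ` ?D" "b \<in> ?I ` ?D" unfolding imgI by auto
      then obtain x y where "x \<in> ?D" "y \<in> ?D" "a = ?I x" "b = ?I y" by blast
      then have "(x, y) \<in> ?S" "p = map_prod ?I ?I (x, y)"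
        using p tableau_perm(2)[OF T] by auto
      then show "p \<in> map_prod ?I ?I ` ?S" by blast
    qed
  qed
  finally show ?thesis by (simp add: inv_count_def)
qed

text \<open>Exchange the products: \<open>z i\<close> occurs once for every node in a component
  before \<open>i\<close>, and these nodes form the diagram of the first \<open>i - 1\<close>
  components. The range starts at 2 because no component precedes the first.\<close>

lemma prod_components:
  fixes z :: "nat \<Rightarrow> 'r::comm_monoid_mult"
  assumes \<Lambda>: "\<Lambda> \<in> multipartitions ell n" and t: "t \<in> standard_tableaux \<Lambda>"
  shows "(\<Prod>j=1..n. \<Prod>i=component \<Lambda> t j + 1..ell. z i) = (\<Prod>i=2..ell. z i ^ mp_size (take (i - 1) \<Lambda>))"
proof -
  let ?D = "diagram \<Lambda>"
  have size: "mp_size \<Lambda> = n" "length \<Lambda> = ell" using \<Lambda> by (auto simp: multipartitions_def)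
  have bij: "bij_betw t ?D {1..n}"
    using tableau_bij[OF standard_tableaux_tableaux[OF t]] size by simp
  have comp: "component \<Lambda> t (t x) = snd (snd x)" if "x \<in> ?D" for x
    using inv_into_f_f[OF bij_betw_imp_inj_on[OF bij] that] by (simp add: component_def position_def)
  have "(\<Prod>j=1..n. \<Prod>i=component \<Lambda> t j + 1..ell. z i) =
    (\<Prod>x\<in>?D. \<Prod>i=component \<Lambda> t (t x) + 1..ell. z i)"
    by (rule prod.reindex_bij_betw[OF bij, symmetric])
  also have "\<dots> = (\<Prod>x\<in>?D. \<Prod>i | i \<in> {2..ell} \<and> snd (snd x) < i. z i)"
  proof (rule prod.cong[OF refl], rule prod.cong)
    fix x assume "x \<in> ?D"
    then show "{component \<Lambda> t (t x) + 1..ell} = {i. i \<in> {2..ell} \<and> snd (snd x) < i}"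
      by (auto simp: comp) (auto simp: diagram_def)
  qed simp
  also have "\<dots> = (\<Prod>i=2..ell. \<Prod>x | x \<in> ?D \<and> snd (snd x) < i. z i)"
    by (rule prod.swap_restrict) auto
  also have "\<dots> = (\<Prod>i=2..ell. z i ^ mp_size (take (i - 1) \<Lambda>))"
  proof (rule prod.cong[OF refl])
    fix i assume i: "i \<in> {2..ell}"
    then have "{x. x \<in> ?D \<and> snd (snd x) < i} = diagram (take (i - 1) \<Lambda>)"
      using size by (subst diagram_take) auto
    then show "(\<Prod>x | x \<in> ?D \<and> snd (snd x) < i. z i) = z i ^ mp_size (take (i - 1) \<Lambda>)"
      by (simp add: card_diagram)
  qed
  finally show ?thesis .
qed

section \<open>The cyclotomic Hecke algebra\<close>

context cyclotomic_hecke
begin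

section \<open>Transfer of the relations to the quotient of the free algebra\<close>

lemma free_algebra_simps:
  "x \<otimes>\<^bsub>free_algebra n\<^esub> y = x * y" "x \<oplus>\<^bsub>free_algebra n\<^esub> y = x + y"
  "\<one>\<^bsub>free_algebra n\<^esub> = 1" "\<zero>\<^bsub>free_algebra n\<^esub> = 0"
  by (simp_all add: free_algebra_def)

lemma free_algebra_minus:
  fixes x y :: "'r free_alg"
  assumes "x \<in> carrier (free_algebra n)" "y \<in> carrier (free_algebra n)"
  shows "x \<ominus>\<^bsub>free_algebra n\<^esub> y = x - y"
proof -
  interpret ring "free_algebra n :: ('r free_alg) ring" by (rule ring_free_algebra)
  have "\<ominus>\<^bsub>free_algebra n\<^esub> y = - y"
    using assms free_algebra_closed(4)[of y y]
    by (intro minus_equality) (simp_all add: free_algebra_simps)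
  then show ?thesis by (simp add: a_minus_def free_algebra_simps)
qed

lemma free_const_add: "free_const (r + r') = free_const r + free_const r'"
  by (simp add: free_const_def single_add)

lemma free_const_mult: "free_const (r * r') = free_const r * free_const r'"
  by (simp add: free_const_def mult_single)

lemma free_const_one: "free_const 1 = 1"
  by (simp add: free_const_def)

context
  assumes n_pos: "n \<ge> 1"
begin

lemma ring_hecke: "ring hecke"
  unfolding hecke_def by (rule ideal.quotient_is_ring[OF ideal_rel_ideal[OF n_pos]])

lemma to_hecke_hom: "to_hecke \<in> ring_hom (free_algebra n) hecke"
  using ideal.rcos_ring_hom[OF ideal_rel_ideal[OF n_pos]]
  by (simp add: to_hecke_def[abs_def] hecke_def)

lemma to_hecke_closed: "a \<in> carrier (free_algebra n) \<Longrightarrow> to_hecke a \<in> carrier hecke"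
  by (rule ring_hom_closed[OF to_hecke_hom])

lemma to_hecke_mult:
  "a \<in> carrier (free_algebra n) \<Longrightarrow> b \<in> carrier (free_algebra n) \<Longrightarrow>
    to_hecke (a * b) = to_hecke a \<otimes>\<^bsub>hecke\<^esub> to_hecke b"
  using ring_hom_mult[OF to_hecke_hom] by (simp add: free_algebra_simps)

lemma to_hecke_add:
  "a \<in> carrier (free_algebra n) \<Longrightarrow> b \<in> carrier (free_algebra n) \<Longrightarrow>
    to_hecke (a + b) = to_hecke a \<oplus>\<^bsub>hecke\<^esub> to_hecke b"
  using ring_hom_add[OF to_hecke_hom] by (simp add: free_algebra_simps)

lemma to_hecke_one: "to_hecke 1 = \<one>\<^bsub>hecke\<^esub>"
  using ring_hom_one[OF to_hecke_hom] by (simp add: free_algebra_simps)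

lemma to_hecke_eqI:
  assumes "a \<in> carrier (free_algebra n)" "b \<in> carrier (free_algebra n)" "a - b \<in> relators"
  shows "to_hecke a = to_hecke b"
proof -
  interpret I: ideal rel_ideal "free_algebra n :: ('r free_alg) ring"
    by (rule ideal_rel_ideal[OF n_pos])
  have "a - b \<in> rel_ideal"
    using assms(3) I.genideal_self[OF relators_carrier[OF n_pos]] by (auto simp: rel_ideal_def)
  then show ?thesis
    using I.quotient_eq_iff_same_a_r_cos[OF I.is_ideal assms(1,2)] free_algebra_minus[OF assms(1,2)]
    by (simp add: to_hecke_def)
qed

lemmas free_closed = free_var_carrier free_const_carrier free_algebra_closed

lemma hecke_relations_hecke:
  assumes "q dvd 1"
  shows "hecke_relations hecke n T q (unit_inverse q) scalar jucys_murphy"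
proof -
  interpret ring hecke by (rule ring_hecke)
  have T: "T i \<in> carrier hecke" if "i < n" for i
    unfolding T_def using that by (intro to_hecke_closed free_closed)
  \<comment> \<open>\<open>unit_inverse\<close> is a definite description; uniqueness is
    cancellation in the integral domain.\<close>
  have unit: "q * unit_inverse q = 1"
  proof -
    obtain r where r: "q * r = 1" using assms by (auto elim: dvdE)
    then have "q \<noteq> 0" by auto
    have "r' = r" if "q * r' = 1" for r'
      using that r \<open>q \<noteq> 0\<close> by (metis mult_cancel_left)
    with r show ?thesis unfolding unit_inverse_def by (rule theI)
  qed
  show ?thesis
  proof unfold_locales
    show "T i \<in> carrier hecke" if "i < n" for i using that by (rule T)
    show "T i \<otimes>\<^bsub>hecke\<^esub> T j = T j \<otimes>\<^bsub>hecke\<^esub> T i" if "i + 1 < j" "j < n" for i j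
    proof -
      have "free_var i * free_var j - free_var j * free_var i \<in> relators"
        unfolding relators_def using that by blast
      then have "to_hecke (free_var i * free_var j) = to_hecke (free_var j * free_var i)"
        using that by (intro to_hecke_eqI free_closed) auto
      then show ?thesis
        using that by (simp add: T_def to_hecke_mult free_closed)
    qed
    show "T i \<otimes>\<^bsub>hecke\<^esub> T (i + 1) \<otimes>\<^bsub>hecke\<^esub> T i = T (i + 1) \<otimes>\<^bsub>hecke\<^esub> T i \<otimes>\<^bsub>hecke\<^esub> T (i + 1)"
      if "1 \<le> i" "i + 1 < n" for i
    proof -
      have "free_var i * free_var (i + 1) * free_var i - free_var (i + 1) * free_var i * free_var (i + 1) \<in> relators"
        unfolding relators_def using that by blast
      then have "to_hecke (free_var i * free_var (i + 1) * free_var i) =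
          to_hecke (free_var (i + 1) * free_var i * free_var (i + 1))"
        using that by (intro to_hecke_eqI free_closed) auto
      then show ?thesis
        using that by (simp add: T_def to_hecke_mult free_closed)
    qed
    show "T 0 \<otimes>\<^bsub>hecke\<^esub> T 1 \<otimes>\<^bsub>hecke\<^esub> T 0 \<otimes>\<^bsub>hecke\<^esub> T 1 = T 1 \<otimes>\<^bsub>hecke\<^esub> T 0 \<otimes>\<^bsub>hecke\<^esub> T 1 \<otimes>\<^bsub>hecke\<^esub> T 0"
      if "1 < n"
    proof -
      have "free_var 0 * free_var 1 * free_var 0 * free_var 1
          - free_var 1 * free_var 0 * free_var 1 * free_var 0 \<in> relators"
        unfolding relators_def using that by simp
      then have "to_hecke (free_var 0 * free_var 1 * free_var 0 * free_var 1) =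
          to_hecke (free_var 1 * free_var 0 * free_var 1 * free_var 0)"
        using that by (intro to_hecke_eqI free_closed) auto
      then show ?thesis
        using that by (simp add: T_def to_hecke_mult free_closed)
    qed
    show "T i \<otimes>\<^bsub>hecke\<^esub> T i = scalar (q - 1) \<otimes>\<^bsub>hecke\<^esub> T i \<oplus>\<^bsub>hecke\<^esub> scalar q"
      if "1 \<le> i" "i < n" for i
    proof -
      have "free_const q = free_const (q - 1) + 1"
        using free_const_add[of "q - 1" 1] by (simp add: free_const_one)
      then have "free_var i * free_var i - (free_const (q - 1) * free_var i + free_const q) =
          (free_var i - free_const q) * (free_var i + 1)"
        by (simp add: algebra_simps)
      also have "\<dots> \<in> relators"
        unfolding relators_def using that by blast
      finally have "to_hecke (free_var i * free_var i) =
          to_hecke (free_const (q - 1) * free_var i + free_const q)"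
        using that by (intro to_hecke_eqI free_closed) auto
      then show ?thesis
        using that by (simp add: T_def scalar_def to_hecke_mult to_hecke_add free_closed)
    qed
    show "scalar r \<in> carrier hecke" for r
      by (simp add: scalar_def to_hecke_closed free_closed)
    show "scalar (r + r') = scalar r \<oplus>\<^bsub>hecke\<^esub> scalar r'" for r r'
      by (simp add: scalar_def free_const_add to_hecke_add free_closed)
    show "scalar (r * r') = scalar r \<otimes>\<^bsub>hecke\<^esub> scalar r'" for r r'
      by (simp add: scalar_def free_const_mult to_hecke_mult free_closed)
    show "scalar 1 = \<one>\<^bsub>hecke\<^esub>"
      by (simp add: scalar_def free_const_one to_hecke_one)
    show "x \<otimes>\<^bsub>hecke\<^esub> scalar r = scalar r \<otimes>\<^bsub>hecke\<^esub> x" if "x \<in> carrier hecke" for x r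
    proof -
      obtain a where a: "a \<in> carrier (free_algebra n)" "x = to_hecke a"
        using \<open>x \<in> carrier hecke\<close> by (auto simp: hecke_def FactRing_def A_RCOSETS_def' to_hecke_def)
      have "to_hecke (a * free_const r) = to_hecke (free_const r * a)"
        by (simp only: free_const_central)
      then show ?thesis
        using a by (simp add: scalar_def to_hecke_mult free_closed)
    qed
    show "jucys_murphy 1 = T 0" by simp
    show "jucys_murphy (Suc k) =
        scalar (unit_inverse q) \<otimes>\<^bsub>hecke\<^esub> T k \<otimes>\<^bsub>hecke\<^esub> jucys_murphy k \<otimes>\<^bsub>hecke\<^esub> T k"
      if "1 \<le> k" "k < n" for k
      using that by (cases k) simp_all
  qed (use n_pos unit in auto)
qed

lemma T_perm_eq:
  assumes "q dvd 1"
  shows "T_perm w = braid_monoid.T_of_perm hecke n T w"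
proof -
  interpret hecke_relations hecke n T q "unit_inverse q" scalar jucys_murphy
    by (rule hecke_relations_hecke[OF assms])
  show ?thesis
    by (simp add: T_perm_def lprod_def T_of_perm_def T_word_def)
qed

lemma hecke_form_hecke:
  assumes "q dvd 1" and \<tau>: "standard_form \<tau>"
  shows "hecke_form hecke n T q (unit_inverse q) scalar jucys_murphy (ell - 1) \<tau>"
proof -
  interpret hecke_relations hecke n T q "unit_inverse q" scalar jucys_murphy
    by (rule hecke_relations_hecke[OF assms(1)])
  show ?thesis
  proof
    show "\<tau> (x \<oplus>\<^bsub>hecke\<^esub> y) = \<tau> x + \<tau> y" if "x \<in> carrier hecke" "y \<in> carrier hecke" for x y
      using \<tau> that unfolding standard_form_def by blast
    show "\<tau> (scalar r \<otimes>\<^bsub>hecke\<^esub> x) = r * \<tau> x" if "x \<in> carrier hecke" for r x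
      using \<tau> that unfolding standard_form_def by blast
    show "\<tau> (L_mono c \<otimes>\<^bsub>hecke\<^esub> T_of_perm w) = (if w = id \<and> (\<forall>i\<in>{1..n}. c i = 0) then 1 else 0)"
      if "w permutes {1..n}" "\<And>i. i \<in> {1..n} \<Longrightarrow> c i \<le> ell - 1" for w c
    proof -
      have "ariki_koike c w = L_mono c \<otimes>\<^bsub>hecke\<^esub> T_of_perm w"
        by (simp only: ariki_koike_def L_mono_def lprod_def T_perm_eq[OF assms(1)])
      then show ?thesis
        using \<tau> that unfolding standard_form_def by metis
    qed
  qed
qed

lemma star_T_word:
  assumes "q dvd 1" "set is \<subseteq> {..<n}"
  shows "star (lprod (map T is)) = lprod (map T (rev is))"
proof -
  interpret hecke_relations hecke n T q "unit_inverse q" scalar jucys_murphy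
    by (rule hecke_relations_hecke[OF assms(1)])
  note anti = star_anti_automorphism[OF n_pos]
  have one: "star \<one>\<^bsub>hecke\<^esub> = \<one>\<^bsub>hecke\<^esub>"
    using anti(4)[of 1] sc_one by simp
  have "star (T_word is) = T_word (rev is)"
    using assms(2)
  proof (induction "is")
    case (Cons i "is")
    then have "star (T i \<otimes>\<^bsub>hecke\<^esub> T_word is) = star (T_word is) \<otimes>\<^bsub>hecke\<^esub> star (T i)"
      by (intro anti(3)) (simp_all add: T_word_closed)
    then show ?case
      using Cons T_word_append[of "rev is" "[i]"] by (simp add: anti(5))
  qed (simp add: one)
  then show ?thesis by (simp only: T_word_def lprod_def)
qed

end

section \<open>The factor \<open>u\<close> as a list of linear factors\<close>

definition u_factors :: "multipartition \<Rightarrow> (nat \<times> 'r) list" where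
  "u_factors \<Lambda> =
    concat (map (\<lambda>s. map (\<lambda>k. (k, Q s)) [1..<Suc (mp_size (take (s - 1) \<Lambda>))]) [2..<Suc ell])"

lemma u_elt_eq:
  "u_elt \<Lambda> = lprod (map (\<lambda>(k, r). jucys_murphy k \<ominus>\<^bsub>hecke\<^esub> scalar r) (u_factors \<Lambda>))"
  by (simp add: u_elt_def u_factors_def map_concat o_def del: upt_Suc)

lemma u_factors_index:
  assumes "\<Lambda> \<in> multipartitions ell n"
  shows "fst ` set (u_factors \<Lambda>) \<subseteq> {1..n}"
proof -
  have le: "mp_size (take i \<Lambda>) \<le> n" for i
    using assms sum_list_take_le[of i "map sum_list \<Lambda>"]
    by (simp add: multipartitions_def mp_size_take) (simp add: mp_size_def)
  show ?thesis
  proof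
    fix k assume "k \<in> fst ` set (u_factors \<Lambda>)"
    then obtain s where "1 \<le> k" "k \<le> mp_size (take (s - 1) \<Lambda>)"
      by (auto simp: u_factors_def less_Suc_eq_le simp del: upt_Suc)
    with le[of "s - 1"] show "k \<in> {1..n}" by simp
  qed
qed

text \<open>Each \<open>s\<close> from 2 to \<open>ell\<close> contributes an index at most once,
  and there are \<open>ell - 1\<close> such \<open>s\<close>. This is exactly the largest exponent
  allowed in the Ariki--Koike basis.\<close>

lemma u_factors_count: "length (filter (\<lambda>p. fst p = k) (u_factors \<Lambda>)) \<le> ell - 1"
proof -
  have row: "length (filter (\<lambda>p. fst p = k) (map (\<lambda>k. (k, Q s)) [1..<m])) \<le> 1" for s m
  proof -
    have "distinct (filter (\<lambda>p. fst p = k) (map (\<lambda>k. (k, Q s)) [1..<m]))"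
      by (intro distinct_filter) (simp add: distinct_map inj_on_def)
    then have "length (filter (\<lambda>p. fst p = k) (map (\<lambda>k. (k, Q s)) [1..<m])) =
        card (set (filter (\<lambda>p. fst p = k) (map (\<lambda>k. (k, Q s)) [1..<m])))"
      by (simp only: distinct_card)
    also have "\<dots> \<le> card {(k, Q s)}"
      by (intro card_mono) auto
    finally show ?thesis by simp
  qed
  have "length (filter (\<lambda>p. fst p = k) (concat (map (\<lambda>s. map (\<lambda>k. (k, Q s)) [1..<g s]) ss))) \<le> length ss"
    for g ss
  proof (induction ss)
    case (Cons s ss)
    then show ?case using row[of s "g s"] by simp
  qed simp
  then show ?thesis
    unfolding u_factors_def by (rule order_trans) (cases ell; auto)
qed

lemma u_factors_constant:
  "(\<Prod>p\<leftarrow>u_factors \<Lambda>. - snd p) = (\<Prod>i=2..ell. (- Q i) ^ mp_size (take (i - 1) \<Lambda>))"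
proof -
  have "(\<Prod>p\<leftarrow>concat (map (\<lambda>s. map (\<lambda>k. (k, Q s)) [1..<Suc (g s)]) ss). - snd p) =
    (\<Prod>s\<leftarrow>ss. (- Q s) ^ g s)" for g :: "nat \<Rightarrow> nat" and ss
    by (induction ss) (simp_all add: o_def map_replicate_const prod_list_replicate del: upt_Suc)
  then have "(\<Prod>p\<leftarrow>u_factors \<Lambda>. - snd p) =
      (\<Prod>s\<leftarrow>[2..<Suc ell]. (- Q s) ^ mp_size (take (s - 1) \<Lambda>))"
    unfolding u_factors_def .
  also have "\<dots> = (\<Prod>i=2..ell. (- Q i) ^ mp_size (take (i - 1) \<Lambda>))"
    by (subst prod.distinct_set_conv_list[symmetric])
      (simp_all add: atLeastLessThanSuc_atLeastAtMost del: upt_Suc)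
  finally show ?thesis .
qed

end

theorem theorem1p9:
  fixes ell n :: nat
    and q :: "'r::idom"
    and Q :: "nat \<Rightarrow> 'r"
    and \<tau> :: "'r free_alg set \<Rightarrow> 'r"
    and \<Lambda> :: multipartition
    and s t :: tableau
  assumes "ell \<ge> 1"
    and "n \<ge> 1"
    and "q dvd 1"
    and "q \<noteq> 1"
    and "cyclotomic_hecke.standard_form ell n q Q \<tau>"
    and "\<Lambda> \<in> multipartitions ell n"
    and "s \<in> standard_tableaux \<Lambda>"
    and "t \<in> standard_tableaux \<Lambda>"
  shows "\<tau> (cyclotomic_hecke.murphy ell n q Q \<Lambda> s t) =
    (if s = t
     then q ^ (\<Sum>k=1..n. k - last_index (sub_shape \<Lambda> t k) (sub_tableau \<Lambda> t k))
          * (\<Prod>j=1..n. \<Prod>i=component \<Lambda> t j + 1..ell. - Q i)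
     else 0)"
proof -
  interpret C: cyclotomic_hecke ell n q Q .
  interpret hecke_form C.hecke n C.T q "unit_inverse q" C.scalar C.jucys_murphy "ell - 1" \<tau>
    by (rule C.hecke_form_hecke[OF assms(2,3,5)])
  let ?a = "concat \<Lambda>" and ?ds = "tableau_perm \<Lambda> s" and ?dt = "tableau_perm \<Lambda> t"
  have size: "mp_size \<Lambda> = n" using assms(6) by (simp add: multipartitions_def)
  note perm = tableau_perm(1)[of _ \<Lambda>, OF standard_tableaux_tableaux, unfolded size]
  note incr = block_increasing_tableau_perm
  \<comment> \<open>A word for the permutation of \<open>s\<close> is fixed because the
    anti-automorphism acts on words by reversal, the form required by
    \<open>\<tau>_murphy_product\<close>.\<close>
  obtain "is" where is_red: "reduced_word n is" and is_perm: "perm_of_word is = ?ds"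
    by (rule ex_reduced_word[OF perm[OF assms(7)]])
  have len: "length is = inv_count n ?ds"
    using is_red by (simp only: reduced_word_def is_perm)
  have star: "C.star (T_of_perm ?ds) = T_word (rev is)"
    using C.star_T_word[OF assms(2,3) reduced_word_lessThan[OF is_red]] T_of_perm_eq[OF is_red]
    by (simp only: is_perm T_word_def C.lprod_def)
  have u: "C.u_elt \<Lambda> = L_factors (C.u_factors \<Lambda>)"
    by (simp only: C.u_elt_eq L_factors_def C.lprod_def)
  have murphy: "C.murphy \<Lambda> s t = T_word (rev is) \<otimes>\<^bsub>C.hecke\<^esub>
      ((\<Oplus>\<^bsub>C.hecke\<^esub>w\<in>young_subgroup ?a. T_of_perm w) \<otimes>\<^bsub>C.hecke\<^esub> L_factors (C.u_factors \<Lambda>))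
      \<otimes>\<^bsub>C.hecke\<^esub> T_of_perm ?dt"
    by (simp only: C.murphy_def C.x_elt_def u C.T_perm_eq[OF assms(2,3)] star)
  have "\<tau> (C.murphy \<Lambda> s t) = (\<Prod>p\<leftarrow>C.u_factors \<Lambda>. - snd p) *
      (\<Sum>w\<in>young_subgroup ?a. if ?dt \<circ> w = perm_of_word is then q ^ length is else 0)"
    unfolding murphy
  proof (rule \<tau>_murphy_product[OF C.u_factors_index[OF assms(6)] C.u_factors_count is_red perm[OF assms(8)]
        finite_young_subgroup])
    show "w permutes {1..n}" if "w \<in> young_subgroup ?a" for w
      using young_subgroup_permutes[OF that] by (simp add: mp_size_concat size)
    show "?dt (w k) < ?dt (w j)" if "w \<in> young_subgroup ?a" "j < k" "w k < w j" for w j k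
      using block_increasing_inversion[OF that(1) incr[OF assms(8)] that(2,3)] .
  qed
  moreover have "(\<Sum>w\<in>young_subgroup ?a. if ?dt \<circ> w = perm_of_word is then q ^ length is else 0) =
      (if ?dt = ?ds then q ^ inv_count n ?ds else 0)"
    unfolding is_perm len by (rule sum_young_subgroup_coset[OF incr[OF assms(8)] incr[OF assms(7)]])
  moreover have "(if ?dt = ?ds then q ^ inv_count n ?ds else 0) = (if s = t then q ^ inv_count n ?dt else 0)"
    using tableau_perm_inj[OF standard_tableaux_tableaux[OF assms(7)] standard_tableaux_tableaux[OF assms(8)]]
    by auto
  moreover have "(\<Prod>p\<leftarrow>C.u_factors \<Lambda>. - snd p) = (\<Prod>j=1..n. \<Prod>i=component \<Lambda> t j + 1..ell. - Q i)"
    unfolding C.u_factors_constant by (rule prod_components[OF assms(6,8), symmetric])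
  ultimately show ?thesis
    unfolding inv_count_tableau_perm[OF assms(6,8)] by (simp add: mult.commute)
qed

end
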